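(* Let $n,d\ge1$, let $C\in\mathbb{R}^{nd\times nd}$ be symmetric, and let $f:\mathcal{Q}\to\mathbb{R}$, $f([G])=\operatorname{tr}(G^\top CG)$, on the quotient manifold $\mathcal{Q}=\mathcal{O}(d)^n/\mathcal{O}(d)$. For every $[G]\in\mathcal{Q}$, every $\bar G\in\pi^{-1}([G])$ and every $H_{[G]}\in\operatorname{T}_{[G]}\mathcal{Q}$ with horizontal lift $\bar H_{\bar G}$ at $\bar G$, the unique horizontal lift at $\bar G$ of the Riemannian Hessian of $f$ at $[G]$ applied to $H_{[G]}$ is $$\overline{\operatorname{Hess} f([G])[H_{[G]}]}_{\bar G}=\Big(I_{nd}-\frac1n\bar G\bar G^\top\Big)\Big(\operatorname{Proj}_{\operatorname{T}_{\bar G}\mathcal{O}(d)^n}\big(-2S(\bar G)\bar H_{\bar G}\big)\Big),$$ where $S(X):=\operatorname{symblockdiag}(CXX^\top)-C\in\mathbb{R}^{nd\times nd}$ for $X\in\mathbb{R}^{nd\times d}$, and $\operatorname{Proj}_{\operatorname{T}_{\bar G}\mathcal{O}(d)^n}$ is the orthogonal projection of $\mathbb{R}^{nd\times d}$ onto $\operatorname{T}_{\bar G}\mathcal{O}(d)^n$.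
   Context: Matrices in $\mathbb{R}^{nd\times d}$ are written $X=[X_1;\dots;X_n]$ with $d\times d$ blocks; $nd\times nd$ matrices have $d\times d$ blocks $M_{ij}$. $\mathcal{O}(d)^n$ is the set of $X$ with all $X_i$ orthogonal, a Riemannian submanifold of $\mathbb{R}^{nd\times d}$ with the metric $\langle X,Y\rangle=\operatorname{tr}(X^\top Y)$. $\operatorname{symblockdiag}:\mathbb{R}^{nd\times nd}\to\mathbb{R}^{nd\times nd}$ is the linear map with $\operatorname{symblockdiag}(M)_{ii}=\frac{M_{ii}+M_{ii}^\top}{2}$ and $\operatorname{symblockdiag}(M)_{ij}=0$ for $i\ne j$. Explicitly, $\operatorname{Proj}_{\operatorname{T}_{G}\mathcal{O}(d)^n}(X)=X-\operatorname{symblockdiag}(XG^\top)G$. $\mathcal{O}(d)$ acts on $\mathcal{O}(d)^n$ by $(G,Q)\mapsto GQ$; $\pi:\mathcal{O}(d)^n\to\mathcal{Q}$, $\pi(G)=[G]=\{GQ:Q\in\mathcal{O}(d)\}$. The vertical space at $\bar G$ is $\operatorname{T}_{\bar G}(\pi^{-1}([G]))$ and the horizontal space $\mathcal{H}_{\bar G}$ is its orthogonal complement in $\operatorname{T}_{\bar G}\mathcal{O}(d)^n$. The horizontal lift at $\bar G$ of $\xi\in\operatorname{T}_{[G]}\mathcal{Q}$ is the unique $\bar\xi_{\bar G}\in\mathcal{H}_{\bar G}$ with $\operatorname{D}\pi(\bar G)[\bar\xi_{\bar G}]=\xi$. $\mathcal{Q}$ carries the Riemannian metric given by the Frobenius inner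 product of horizontal lifts, and $\operatorname{Hess} f([G])[H]=\nabla_H\operatorname{grad}f$ with $\nabla$ its Levi-Civita connection. *)

theory Defs
  imports "HOL-Analysis.Analysis"
begin

section \<open>Smooth maps between Euclidean spaces\<close>

primrec Ck_on :: "nat \<Rightarrow> ('a::real_normed_vector \<Rightarrow> 'b::real_normed_vector) \<Rightarrow> 'a set \<Rightarrow> bool" where
  "Ck_on 0 f U \<longleftrightarrow> continuous_on U f"
| "Ck_on (Suc k) f U \<longleftrightarrow>
     (\<forall>x\<in>U. f differentiable (at x)) \<and> (\<forall>v. Ck_on k (\<lambda>x. frechet_derivative f (at x) v) U)"

(* Used for open U only, so that the derivative at a point of U is unique. *)
definition smooth_on :: "('a::real_normed_vector \<Rightarrow> 'b::real_normed_vector) \<Rightarrow> 'a set \<Rightarrow> bool" where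
  "smooth_on f U \<longleftrightarrow> (\<forall>k. Ck_on k f U)"


section \<open>Block matrices\<close>

(* Row index (i, a) is row a of the i-th block; the dimensions n = CARD('n) and d = CARD('d)
   are arbitrary positive integers. *)
type_synonym ('n, 'd) tall = "real ^ 'd ^ ('n \<times> 'd)"
type_synonym ('n, 'd) big = "real ^ ('n \<times> 'd) ^ ('n \<times> 'd)"

definition blk :: "('n::finite, 'd::finite) tall \<Rightarrow> 'n \<Rightarrow> real ^ 'd ^ 'd" where
  "blk X i = (\<chi> a b. X $ (i, a) $ b)"

definition blk2 :: "('n::finite, 'd::finite) big \<Rightarrow> 'n \<Rightarrow> 'n \<Rightarrow> real ^ 'd ^ 'd" where
  "blk2 M i j = (\<chi> a b. M $ (i, a) $ (j, b))"

definition symblockdiag :: "('n::finite, 'd::finite) big \<Rightarrow> ('n, 'd) big" where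
  "symblockdiag M = (\<chi> r s.
     if fst r = fst s
     then ((1/2) *\<^sub>R (blk2 M (fst r) (fst r) + transpose (blk2 M (fst r) (fst r)))) $ snd r $ snd s
     else 0)"

definition S_mat :: "('n::finite, 'd::finite) big \<Rightarrow> ('n, 'd) tall \<Rightarrow> ('n, 'd) big" where
  "S_mat C X = symblockdiag (C ** X ** transpose X) - C"

definition frob :: "('n::finite, 'd::finite) tall \<Rightarrow> ('n, 'd) tall \<Rightarrow> real" where
  "frob X Y = trace (transpose X ** Y)"

definition orth_proj :: "('n::finite, 'd::finite) tall set \<Rightarrow> ('n, 'd) tall \<Rightarrow> ('n, 'd) tall" where
  "orth_proj V X = (THE P. P \<in> V \<and> (\<forall>W\<in>V. frob (X - P) W = 0))"


section \<open>Embedded submanifolds of the matrix space\<close>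

definition smooth_curve_in :: "('n::finite, 'd::finite) tall set \<Rightarrow> (real \<Rightarrow> ('n, 'd) tall) \<Rightarrow> bool" where
  "smooth_curve_in M c \<longleftrightarrow> smooth_on c UNIV \<and> (\<forall>t. c t \<in> M)"

definition tangent_space :: "('n::finite, 'd::finite) tall set \<Rightarrow> ('n, 'd) tall \<Rightarrow> ('n, 'd) tall set" where
  "tangent_space M G =
     {vector_derivative c (at 0) | c. smooth_curve_in M c \<and> c 0 = G}"

definition smooth_fun_on :: "('n::finite, 'd::finite) tall set \<Rightarrow> (('n, 'd) tall \<Rightarrow> real) \<Rightarrow> bool" where
  "smooth_fun_on M \<psi> \<longleftrightarrow>
     (\<forall>x\<in>M. \<exists>U g. open U \<and> x \<in> U \<and> smooth_on g U \<and> (\<forall>y\<in>U \<inter> M. g y = \<psi> y))"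

definition orth_prod :: "('n::finite, 'd::finite) tall set" where
  "orth_prod = {X. \<forall>i. orthogonal_matrix (blk X i)}"


section \<open>The quotient manifold\<close>

definition quot :: "('n::finite, 'd::finite) tall \<Rightarrow> ('n, 'd) tall set" where
  "quot G = {G ** Q | Q :: real ^ 'd ^ 'd. orthogonal_matrix Q}"

definition quot_mfd :: "('n::finite, 'd::finite) tall set set" where
  "quot_mfd = quot ` orth_prod"

(* The quotient manifold structure is the one making the projection a smooth submersion;
   equivalently, a function on the quotient is smooth iff its pullback is. *)
definition smooth_quot_fun :: "(('n::finite, 'd::finite) tall set \<Rightarrow> real) \<Rightarrow> bool" where
  "smooth_quot_fun \<phi> \<longleftrightarrow> smooth_fun_on orth_prod (\<phi> \<circ> quot)"

(* A curve in a manifold is smooth iff its composition with every smooth function is. *)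
definition smooth_quot_curve :: "(real \<Rightarrow> ('n::finite, 'd::finite) tall set) \<Rightarrow> bool" where
  "smooth_quot_curve \<gamma> \<longleftrightarrow>
     (\<forall>t. \<gamma> t \<in> quot_mfd) \<and> (\<forall>\<phi>. smooth_quot_fun \<phi> \<longrightarrow> smooth_on (\<phi> \<circ> \<gamma>) UNIV)"

(* Tangent vectors act on smooth functions as derivatives along curves. The value 0 on
   functions that are not smooth is only there to make equality of tangent vectors extensional. *)
type_synonym ('n, 'd) qtangent = "(('n, 'd) tall set \<Rightarrow> real) \<Rightarrow> real"

definition velocity :: "(real \<Rightarrow> ('n::finite, 'd::finite) tall set) \<Rightarrow> ('n, 'd) qtangent" where
  "velocity \<gamma> = (\<lambda>\<phi>. if smooth_quot_fun \<phi> then deriv (\<phi> \<circ> \<gamma>) 0 else 0)"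

definition quot_tangent_space :: "('n::finite, 'd::finite) tall set \<Rightarrow> ('n, 'd) qtangent set" where
  "quot_tangent_space p = {velocity \<gamma> | \<gamma>. smooth_quot_curve \<gamma> \<and> \<gamma> 0 = p}"

(* The differential of the projection at G, for v tangent to orth_prod at G. *)
definition quot_diff :: "('n::finite, 'd::finite) tall \<Rightarrow> ('n, 'd) tall \<Rightarrow> ('n, 'd) qtangent" where
  "quot_diff G v = (THE \<xi>. \<forall>c. smooth_curve_in orth_prod c \<and> c 0 = G \<and> vector_derivative c (at 0) = v
     \<longrightarrow> \<xi> = velocity (quot \<circ> c))"

definition vertical_space :: "('n::finite, 'd::finite) tall \<Rightarrow> ('n, 'd) tall set" where
  "vertical_space G = tangent_space {G' \<in> orth_prod. quot G' = quot G} G"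

definition horizontal_space :: "('n::finite, 'd::finite) tall \<Rightarrow> ('n, 'd) tall set" where
  "horizontal_space G = {v \<in> tangent_space orth_prod G. \<forall>w\<in>vertical_space G. frob v w = 0}"

definition is_horizontal_lift ::
    "('n::finite, 'd::finite) tall \<Rightarrow> ('n, 'd) qtangent \<Rightarrow> ('n, 'd) tall \<Rightarrow> bool" where
  "is_horizontal_lift G \<xi> v \<longleftrightarrow> v \<in> horizontal_space G \<and> quot_diff G v = \<xi>"

definition horizontal_lift ::
    "('n::finite, 'd::finite) tall \<Rightarrow> ('n, 'd) qtangent \<Rightarrow> ('n, 'd) tall" where
  "horizontal_lift G \<xi> = (THE v. is_horizontal_lift G \<xi> v)"


section \<open>Riemannian geometry of the quotient\<close>

(* The point p is itself the fibre over p, so G ranges over all representatives. *)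
definition quot_metric ::
    "('n::finite, 'd::finite) tall set \<Rightarrow> ('n, 'd) qtangent \<Rightarrow> ('n, 'd) qtangent \<Rightarrow> real" where
  "quot_metric p \<xi> \<eta> = (THE r. \<forall>G\<in>p. r = frob (horizontal_lift G \<xi>) (horizontal_lift G \<eta>))"

type_synonym ('n, 'd) qfield = "('n, 'd) tall set \<Rightarrow> ('n, 'd) qtangent"

(* Smooth vector fields on the quotient, extended by 0 to the sets that are not orbits. *)
definition vector_fields :: "('n::finite, 'd::finite) qfield set" where
  "vector_fields = {X. (\<forall>p\<in>quot_mfd. X p \<in> quot_tangent_space p) \<and>
                       (\<forall>p. p \<notin> quot_mfd \<longrightarrow> X p = (\<lambda>\<phi>. 0)) \<and>
                       (\<forall>\<phi>. smooth_quot_fun \<phi> \<longrightarrow> smooth_quot_fun (\<lambda>p. X p \<phi>))}"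

definition field_add ::
    "('n::finite, 'd::finite) qfield \<Rightarrow> ('n, 'd) qfield \<Rightarrow> ('n, 'd) qfield" where
  "field_add X Y = (\<lambda>p \<phi>. X p \<phi> + Y p \<phi>)"

definition field_scale ::
    "(('n::finite, 'd::finite) tall set \<Rightarrow> real) \<Rightarrow> ('n, 'd) qfield \<Rightarrow> ('n, 'd) qfield" where
  "field_scale h X = (\<lambda>p \<phi>. h p * X p \<phi>)"

definition affine_connection ::
    "(('n::finite, 'd::finite) qfield \<Rightarrow> ('n, 'd) qfield \<Rightarrow> ('n, 'd) qfield) \<Rightarrow> bool" where
  "affine_connection D \<longleftrightarrow>
     (\<forall>X\<in>vector_fields. \<forall>Y\<in>vector_fields. D X Y \<in> vector_fields) \<and>
     (\<forall>X\<in>vector_fields. \<forall>X'\<in>vector_fields. \<forall>Y\<in>vector_fields.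
        D (field_add X X') Y = field_add (D X Y) (D X' Y)) \<and>
     (\<forall>h. \<forall>X\<in>vector_fields. \<forall>Y\<in>vector_fields. smooth_quot_fun h \<longrightarrow>
        D (field_scale h X) Y = field_scale h (D X Y)) \<and>
     (\<forall>X\<in>vector_fields. \<forall>Y\<in>vector_fields. \<forall>Y'\<in>vector_fields.
        D X (field_add Y Y') = field_add (D X Y) (D X Y')) \<and>
     (\<forall>h. \<forall>X\<in>vector_fields. \<forall>Y\<in>vector_fields. smooth_quot_fun h \<longrightarrow>
        D X (field_scale h Y) = field_add (field_scale (\<lambda>p. X p h) Y) (field_scale h (D X Y)))"

definition torsion_free ::
    "(('n::finite, 'd::finite) qfield \<Rightarrow> ('n, 'd) qfield \<Rightarrow> ('n, 'd) qfield) \<Rightarrow> bool" where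
  "torsion_free D \<longleftrightarrow>
     (\<forall>X\<in>vector_fields. \<forall>Y\<in>vector_fields. \<forall>p\<in>quot_mfd. \<forall>\<phi>. smooth_quot_fun \<phi> \<longrightarrow>
        D X Y p \<phi> - D Y X p \<phi> = X p (\<lambda>q. Y q \<phi>) - Y p (\<lambda>q. X q \<phi>))"

definition metric_compatible ::
    "(('n::finite, 'd::finite) qfield \<Rightarrow> ('n, 'd) qfield \<Rightarrow> ('n, 'd) qfield) \<Rightarrow> bool" where
  "metric_compatible D \<longleftrightarrow>
     (\<forall>X\<in>vector_fields. \<forall>Y\<in>vector_fields. \<forall>Z\<in>vector_fields. \<forall>p\<in>quot_mfd.
        X p (\<lambda>q. quot_metric q (Y q) (Z q)) =
          quot_metric p (D X Y p) (Z p) + quot_metric p (Y p) (D X Z p))"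

(* The last clause fixes irrelevant values, so that the connection is unique as a HOL function. *)
definition levi_civita ::
    "('n::finite, 'd::finite) qfield \<Rightarrow> ('n, 'd) qfield \<Rightarrow> ('n, 'd) qfield" where
  "levi_civita = (THE D. affine_connection D \<and> torsion_free D \<and> metric_compatible D \<and>
     (\<forall>X Y. X \<notin> vector_fields \<or> Y \<notin> vector_fields \<longrightarrow> D X Y = (\<lambda>p \<phi>. 0)))"

definition quot_grad :: "(('n::finite, 'd::finite) tall set \<Rightarrow> real) \<Rightarrow> ('n, 'd) qfield" where
  "quot_grad f = (\<lambda>p. if p \<in> quot_mfd
     then THE \<eta>. \<eta> \<in> quot_tangent_space p \<and> (\<forall>\<xi>\<in>quot_tangent_space p. quot_metric p \<eta> \<xi> = \<xi> f)
     else (\<lambda>\<phi>. 0))"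

(* The derivative of the gradient in direction H at p: the value at p does not depend on the
   smooth field X extending H. *)
definition quot_Hess :: "(('n::finite, 'd::finite) tall set \<Rightarrow> real) \<Rightarrow> ('n, 'd) tall set \<Rightarrow>
    ('n, 'd) qtangent \<Rightarrow> ('n, 'd) qtangent" where
  "quot_Hess f p H = (THE \<eta>. \<forall>X\<in>vector_fields. X p = H \<longrightarrow> \<eta> = levi_civita X (quot_grad f) p)"

end

theory Submission
  imports Defs
begin

text \<open>
  A tangent vector of the quotient at [G] is the derivation along a unique horizontal vector v at G.
  The invariant embedding that sends [G] to G G^T has derivative G v^T + v G^T, and multiplying it
  by G gives n v, since G^T v = 0 and G^T G = n I. Hence the lift of a smooth vector field is smooth
  and equivariant. With a global section of the projection, vector fields can be
  built from smooth horizontal fields upstairs without any local charts, and the Levi-Civita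
  connection is the horizontal projection of the ordinary derivative of lifts: metric compatibility is
  the product rule, and torsion-freeness follows from the symmetry of second derivatives together
  with the tangency of the difference of the two derivatives of lifts.

  The lift of the gradient of f is -2 S(G) G. Its derivative along v is -2 S(G) v plus a symmetric
  block diagonal multiple of G, which is normal to the product of orthogonal groups and
  therefore disappears under the projection.
\<close>

section \<open>Calculus of smooth maps\<close>

text \<open>Most quotient notions are definite descriptions, so every formula carries an existence
  and a uniqueness obligation: \<open>quot_diff\<close> must not depend on the curve,
  \<open>quot_metric\<close> not on the representative, \<open>levi_civita\<close> requires a
  constructed connection besides uniqueness, and \<open>quot_Hess\<close> requires at least one
  global smooth field through the given tangent vector. Tangent vectors come from curves defined on
  the whole real line and staying in the set, so each solution of the linearised orthogonality
  equations has to be realised by an actual curve. Maps given only on the product of orthogonal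
  groups have no ambient derivative; theirs is read off from local smooth extensions and is
  determined along tangent vectors only, which is why tangency is checked before almost every
  differentiation. Identities on the quotient are checked at one chosen representative per orbit; an
  arbitrary representative is reached through right multiplication by an orthogonal matrix.\<close>

lemma Ck_on_cong:
  assumes "open U" "\<And>x. x \<in> U \<Longrightarrow> f x = g x" "Ck_on k f U"
  shows "Ck_on k g U"
  using assms(2,3)
proof (induction k arbitrary: f g)
  case 0
  then show ?case by (metis Ck_on.simps(1) continuous_on_cong)
next
  case (Suc k)
  have D: "(g has_derivative frechet_derivative f (at x)) (at x)" if "x \<in> U" for x
    using Suc.prems that assms(1)
    by (metis Ck_on.simps(2) frechet_derivative_works has_derivative_transform_within_open)
  have "Ck_on k (\<lambda>x. frechet_derivative g (at x) v) U" for v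
  proof (rule Suc.IH)
    show "Ck_on k (\<lambda>x. frechet_derivative f (at x) v) U" using Suc.prems(2) by simp
  qed (metis D frechet_derivative_at)
  then show ?case using D by (auto simp: differentiable_def)
qed

text \<open>\<open>frechet_derivative\<close> is defined by a choice; this rule admits any known
  formula \<open>f'\<close> for the derivative, since derivatives at a point are unique.\<close>

lemma Ck_on_SucI:
  assumes "open U" "\<And>x. x \<in> U \<Longrightarrow> (f has_derivative f' x) (at x)"
    "\<And>v. Ck_on k (\<lambda>x. f' x v) U"
  shows "Ck_on (Suc k) f U"
proof -
  have "Ck_on k (\<lambda>x. frechet_derivative f (at x) v) U" for v
    by (rule Ck_on_cong[OF assms(1) _ assms(3)[of v]]) (simp add: frechet_derivative_at[OF assms(2)])
  then show ?thesis using assms(2) by (auto simp: differentiable_def)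
qed

lemma Ck_on_SucD:
  assumes "Ck_on (Suc k) f U"
  shows "x \<in> U \<Longrightarrow> (f has_derivative frechet_derivative f (at x)) (at x)"
    and "Ck_on k (\<lambda>x. frechet_derivative f (at x) v) U"
  using assms by (auto simp: frechet_derivative_works)

lemma Ck_on_Suc_imp: "Ck_on (Suc k) f U \<Longrightarrow> Ck_on k f U"
proof (induction k arbitrary: f)
  case 0
  then show ?case
    by (auto intro!: continuous_at_imp_continuous_on differentiable_imp_continuous_within)
next
  case (Suc k)
  then show ?case by (metis Ck_on.simps(2))
qed

lemma Ck_on_subset: "Ck_on k f U \<Longrightarrow> V \<subseteq> U \<Longrightarrow> Ck_on k f V"
  by (induction k arbitrary: f) (auto intro: continuous_on_subset)

lemma Ck_on_local:
  assumes "\<And>x. x \<in> U \<Longrightarrow> \<exists>V. open V \<and> x \<in> V \<and> Ck_on k f V"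
  shows "Ck_on k f U"
  using assms
proof (induction k arbitrary: f)
  case 0
  then show ?case
    unfolding Ck_on.simps by (metis continuous_at_imp_continuous_on continuous_on_eq_continuous_at)
next
  case (Suc k)
  have "Ck_on k (\<lambda>x. frechet_derivative f (at x) v) U" for v
    by (rule Suc.IH) (use Suc.prems in fastforce)
  then show ?case using Suc.prems by fastforce
qed

lemma Ck_on_const: "open U \<Longrightarrow> Ck_on k (\<lambda>x. c) U"
proof (induction k arbitrary: c)
  case (Suc k)
  then show ?case by (intro Ck_on_SucI[where f' = "\<lambda>x v. 0"]) auto
qed auto

lemma Ck_on_bounded_linear:
  assumes "bounded_linear L" "open U"
  shows "Ck_on k f U \<Longrightarrow> Ck_on k (\<lambda>x. L (f x)) U"
proof (induction k arbitrary: f)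
  case 0
  then show ?case by (auto intro: bounded_linear.continuous_on[OF assms(1)])
next
  case (Suc k)
  show ?case
    by (rule Ck_on_SucI[OF assms(2), where f' = "\<lambda>x v. L (frechet_derivative f (at x) v)"])
      (use Suc in \<open>auto intro!: bounded_linear.has_derivative[OF assms(1)] simp: frechet_derivative_works\<close>)
qed

lemma Ck_on_add:
  assumes "open U"
  shows "Ck_on k f U \<Longrightarrow> Ck_on k g U \<Longrightarrow> Ck_on k (\<lambda>x. f x + g x) U"
proof (induction k arbitrary: f g)
  case 0
  then show ?case by (auto intro: continuous_intros)
next
  case (Suc k)
  show ?case
    by (rule Ck_on_SucI[OF assms, where f' = "\<lambda>x v. frechet_derivative f (at x) v + frechet_derivative g (at x) v"])
      (use Suc in \<open>auto intro!: derivative_intros simp: frechet_derivative_works\<close>)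
qed

lemma Ck_on_sum:
  assumes "open U" "\<And>i. i \<in> I \<Longrightarrow> Ck_on k (f i) U"
  shows "Ck_on k (\<lambda>x. \<Sum>i\<in>I. f i x) U"
  using assms(2)
  by (induction I rule: infinite_finite_induct) (auto intro: Ck_on_add Ck_on_const assms(1))

text \<open>The derivative is a sum of two \<open>B\<close>-products, each pairing one factor with
  the derivative of the other. Hence the induction generalises over both factors and lowers the
  order of the undifferentiated one.\<close>

lemma Ck_on_bilinear:
  assumes "bounded_bilinear B" "open U"
  shows "Ck_on k f U \<Longrightarrow> Ck_on k g U \<Longrightarrow> Ck_on k (\<lambda>x. B (f x) (g x)) U"
proof (induction k arbitrary: f g)
  case 0
  then show ?case by (auto intro: bounded_bilinear.continuous_on[OF assms(1)])
next
  case (Suc k)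
  note fg = Suc.prems
  show ?case
  proof (rule Ck_on_SucI[OF assms(2), where f' = "\<lambda>x v. B (f x) (frechet_derivative g (at x) v) + B (frechet_derivative f (at x) v) (g x)"])
    fix x assume "x \<in> U"
    then show "((\<lambda>x. B (f x) (g x)) has_derivative
        (\<lambda>v. B (f x) (frechet_derivative g (at x) v) + B (frechet_derivative f (at x) v) (g x))) (at x)"
      by (intro bounded_bilinear.FDERIV[OF assms(1)] Ck_on_SucD(1)[OF fg(1)] Ck_on_SucD(1)[OF fg(2)])
  next
    fix v
    show "Ck_on k (\<lambda>x. B (f x) (frechet_derivative g (at x) v) + B (frechet_derivative f (at x) v) (g x)) U"
      by (intro Ck_on_add[OF assms(2)] Suc.IH Ck_on_SucD(2)[OF fg(1)] Ck_on_SucD(2)[OF fg(2)]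
          Ck_on_Suc_imp[OF fg(1)] Ck_on_Suc_imp[OF fg(2)])
  qed
qed

text \<open>\<open>Ck_on\<close> controls derivatives in fixed directions only. The expansion turns
  a direction that varies with the point into scalar coefficients in front of finitely many fixed
  directions.\<close>

lemma linear_euclidean_expand:
  fixes L :: "'a::euclidean_space \<Rightarrow> 'b::real_vector"
  assumes "linear L"
  shows "L v = (\<Sum>b\<in>Basis. (v \<bullet> b) *\<^sub>R L b)"
proof -
  have "L v = L (\<Sum>b\<in>Basis. (v \<bullet> b) *\<^sub>R b)" by (simp add: euclidean_representation)
  also have "\<dots> = (\<Sum>b\<in>Basis. (v \<bullet> b) *\<^sub>R L b)"
    by (simp add: linear_sum[OF assms] linear_scale[OF assms] o_def)
  finally show ?thesis .
qed

text \<open>The chain rule applies the derivative of g to a direction that moves with x. Expanding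
  that direction in a basis leaves scalar functions times derivatives of g in fixed directions,
  composed with f, which the induction hypothesis covers. This is why the middle space is
  Euclidean.\<close>

lemma Ck_on_compose:
  fixes f :: "'a::real_normed_vector \<Rightarrow> 'b::euclidean_space"
  assumes "open U" "open V" "f ` U \<subseteq> V"
  shows "Ck_on k g V \<Longrightarrow> Ck_on k f U \<Longrightarrow> Ck_on k (\<lambda>x. g (f x)) U"
proof (induction k arbitrary: g)
  case 0
  then show ?case using assms(3) by (auto intro: continuous_on_compose2)
next
  case (Suc k)
  let ?f' = "\<lambda>x. frechet_derivative f (at x)" and ?g' = "\<lambda>x. frechet_derivative g (at x)"
  have f: "Ck_on k f U" by (rule Ck_on_Suc_imp[OF Suc.prems(2)])
  show ?case
  proof (rule Ck_on_SucI[OF assms(1), where f' = "\<lambda>x v. \<Sum>b\<in>Basis. (?f' x v \<bullet> b) *\<^sub>R ?g' (f x) b"])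
    fix x assume x: "x \<in> U"
    have g: "(g has_derivative ?g' (f x)) (at (f x))"
      using x assms(3) by (intro Ck_on_SucD(1)[OF Suc.prems(1)]) auto
    have "((g \<circ> f) has_derivative ?g' (f x) \<circ> ?f' x) (at x)"
      by (intro diff_chain_at Ck_on_SucD(1)[OF Suc.prems(2)] g x)
    moreover have "?g' (f x) \<circ> ?f' x = (\<lambda>v. \<Sum>b\<in>Basis. (?f' x v \<bullet> b) *\<^sub>R ?g' (f x) b)"
      by (auto simp: fun_eq_iff intro!: linear_euclidean_expand has_derivative_linear[OF g])
    ultimately show "((\<lambda>x. g (f x)) has_derivative (\<lambda>v. \<Sum>b\<in>Basis. (?f' x v \<bullet> b) *\<^sub>R ?g' (f x) b)) (at x)"
      by (simp add: o_def)
  next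
    fix v
    show "Ck_on k (\<lambda>x. \<Sum>b\<in>Basis. (?f' x v \<bullet> b) *\<^sub>R ?g' (f x) b) U"
      by (intro Ck_on_sum Ck_on_bilinear[OF bounded_bilinear_scaleR] assms
          Ck_on_bounded_linear[OF bounded_linear_inner_left] Ck_on_SucD(2)[OF Suc.prems(2)]
          Suc.IH[OF Ck_on_SucD(2)[OF Suc.prems(1)]] f)
  qed
qed

lemma Ck_on_ident: "open U \<Longrightarrow> Ck_on k (\<lambda>x. x) U"
  by (cases k) (auto intro!: Ck_on_SucI[where f' = "\<lambda>x v. v"] Ck_on_const continuous_intros derivative_intros
      simp del: Ck_on.simps(2))

lemma smooth_on_cong: "open U \<Longrightarrow> (\<And>x. x \<in> U \<Longrightarrow> f x = g x) \<Longrightarrow> smooth_on f U \<Longrightarrow> smooth_on g U"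
  unfolding smooth_on_def by (metis Ck_on_cong)

lemma smooth_on_subset: "smooth_on f U \<Longrightarrow> V \<subseteq> U \<Longrightarrow> smooth_on f V"
  unfolding smooth_on_def by (metis Ck_on_subset)

lemma smooth_on_local: "(\<And>x. x \<in> U \<Longrightarrow> \<exists>V. open V \<and> x \<in> V \<and> smooth_on f V) \<Longrightarrow> smooth_on f U"
  unfolding smooth_on_def by (metis Ck_on_local)

lemma smooth_on_const: "open U \<Longrightarrow> smooth_on (\<lambda>x. c) U"
  unfolding smooth_on_def by (metis Ck_on_const)

lemma smooth_on_ident: "open U \<Longrightarrow> smooth_on (\<lambda>x. x) U"
  unfolding smooth_on_def by (metis Ck_on_ident)

lemma smooth_on_bounded_linear:
  "bounded_linear L \<Longrightarrow> open U \<Longrightarrow> smooth_on f U \<Longrightarrow> smooth_on (\<lambda>x. L (f x)) U"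
  unfolding smooth_on_def by (metis Ck_on_bounded_linear)

lemma smooth_on_bilinear:
  "bounded_bilinear B \<Longrightarrow> open U \<Longrightarrow> smooth_on f U \<Longrightarrow> smooth_on g U \<Longrightarrow> smooth_on (\<lambda>x. B (f x) (g x)) U"
  unfolding smooth_on_def by (metis Ck_on_bilinear)

lemma smooth_on_add:
  "open U \<Longrightarrow> smooth_on f U \<Longrightarrow> smooth_on g U \<Longrightarrow> smooth_on (\<lambda>x. f x + g x) U"
  unfolding smooth_on_def by (metis Ck_on_add)

lemma smooth_on_sum:
  "open U \<Longrightarrow> (\<And>i. i \<in> I \<Longrightarrow> smooth_on (f i) U) \<Longrightarrow> smooth_on (\<lambda>x. \<Sum>i\<in>I. f i x) U"
  unfolding smooth_on_def by (metis Ck_on_sum)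

lemma smooth_on_compose:
  fixes f :: "'a::real_normed_vector \<Rightarrow> 'b::euclidean_space"
  shows "open U \<Longrightarrow> open V \<Longrightarrow> f ` U \<subseteq> V \<Longrightarrow> smooth_on g V \<Longrightarrow> smooth_on f U \<Longrightarrow> smooth_on (\<lambda>x. g (f x)) U"
  unfolding smooth_on_def by (metis Ck_on_compose)

lemma smooth_on_has_derivative:
  "smooth_on f U \<Longrightarrow> x \<in> U \<Longrightarrow> (f has_derivative frechet_derivative f (at x)) (at x)"
  unfolding smooth_on_def by (metis Ck_on_SucD(1))

lemma smooth_on_frechet_derivative:
  "smooth_on f U \<Longrightarrow> smooth_on (\<lambda>x. frechet_derivative f (at x) v) U"
  unfolding smooth_on_def by (metis Ck_on_SucD(2))

lemma smooth_on_continuous: "smooth_on f U \<Longrightarrow> continuous_on U f"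
  unfolding smooth_on_def by (metis Ck_on.simps(1))

lemma smooth_on_vec:
  fixes f :: "'a::real_normed_vector \<Rightarrow> 'b::real_normed_vector ^ 'n"
  assumes "open U" "\<And>i. smooth_on (\<lambda>x. f x $ i) U"
  shows "smooth_on f U"
proof -
  have bl: "bounded_linear (axis i :: 'b \<Rightarrow> 'b ^ 'n)" for i
    by (intro bounded_linear_intro[where K = 1])
      (auto simp: vec_eq_iff axis_def norm_vec_def L2_set_def if_distrib[of norm] if_distrib[of "\<lambda>x. x\<^sup>2"] cong: if_cong)
  have "smooth_on (\<lambda>x. \<Sum>i\<in>UNIV. axis i (f x $ i)) U"
    by (intro smooth_on_sum smooth_on_bounded_linear[OF bl] assms)
  then show ?thesis
    by (rule smooth_on_cong[OF assms(1), rotated]) (simp add: vec_eq_iff axis_def)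
qed

text \<open>Each function is, up to sign, the derivative of the other, so the two inductions run
  together.\<close>

lemma smooth_on_sin_cos: "smooth_on sin (UNIV::real set)" "smooth_on cos (UNIV::real set)"
proof -
  have "Ck_on k sin (UNIV::real set) \<and> Ck_on k cos (UNIV::real set)" for k
  proof (induction k)
    case 0
    then show ?case by (auto intro: continuous_intros)
  next
    case (Suc k)
    have bl: "bounded_linear (\<lambda>x::real. v * x)" "bounded_linear (\<lambda>x::real. - x * v)" for v
      using bounded_linear_mult_right[of v] bounded_linear_minus[OF bounded_linear_mult_left[of v]] by simp_all
    show ?case
      using Suc Ck_on_bounded_linear[OF bl(1) open_UNIV, of k cos]
        Ck_on_bounded_linear[OF bl(2) open_UNIV, of k sin]
      by (intro conjI Ck_on_SucI[where f' = "\<lambda>x v. v * cos x"]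
          Ck_on_SucI[where f' = "\<lambda>x v. - sin x * v"])
        (auto intro!: derivative_eq_intros)
  qed
  then show "smooth_on sin (UNIV::real set)" "smooth_on cos (UNIV::real set)"
    by (auto simp: smooth_on_def)
qed

lemma smooth_on_vector_derivative:
  fixes c :: "real \<Rightarrow> 'a::real_normed_vector"
  assumes "smooth_on c UNIV"
  shows "(c has_vector_derivative vector_derivative c (at t)) (at t)"
  using smooth_on_has_derivative[OF assms, of t]
  by (meson UNIV_I differentiableI vector_derivative_works)


subsection \<open>Symmetry of second derivatives\<close>

text \<open>The mean value theorem is used twice: in the first variable for the difference of the
  two slices \<open>h a s\<close> and \<open>h a 0\<close>, and in the second variable for
  \<open>h1 a\<close>. Exchanging the roles of the variables leaves the left-hand side unchanged,
  which is the lever for the symmetry of second derivatives.\<close>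

lemma second_difference_mvt:
  fixes h1 :: "real \<Rightarrow> real \<Rightarrow> real"
  assumes s: "0 < s"
    and h1: "\<And>a b. 0 \<le> a \<Longrightarrow> a \<le> s \<Longrightarrow> 0 \<le> b \<Longrightarrow> b \<le> s \<Longrightarrow> ((\<lambda>a. h a b) has_real_derivative h1 a b) (at a)"
    and h12: "\<And>a b. 0 \<le> a \<Longrightarrow> a \<le> s \<Longrightarrow> 0 \<le> b \<Longrightarrow> b \<le> s \<Longrightarrow> (h1 a has_real_derivative h12 a b) (at b)"
  obtains a b where "0 < a" "a < s" "0 < b" "b < s" "h s s - h s 0 - h 0 s + h 0 0 = s * s * h12 a b"
proof -
  have "\<exists>a>0. a < s \<and> (h s s - h s 0) - (h 0 s - h 0 0) = (s - 0) * (h1 a s - h1 a 0)"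
    by (rule MVT2[OF s, of "\<lambda>a. h a s - h a 0"]) (use s in \<open>auto intro!: derivative_intros h1\<close>)
  then obtain a where a: "0 < a" "a < s" "(h s s - h s 0) - (h 0 s - h 0 0) = s * (h1 a s - h1 a 0)"
    by auto
  have "\<exists>b>0. b < s \<and> h1 a s - h1 a 0 = (s - 0) * h12 a b"
    by (rule MVT2[OF s]) (use a in \<open>auto intro!: h12\<close>)
  then obtain b where "0 < b" "b < s" "h1 a s - h1 a 0 = s * h12 a b" by auto
  with a show ?thesis by (intro that[of a b]) (auto simp: algebra_simps)
qed

lemma smooth_on_mixed_difference:
  fixes g :: "'a::real_normed_vector \<Rightarrow> real"
  assumes g: "smooth_on g U" and s: "0 < s"
    and U: "\<And>a b. 0 \<le> a \<Longrightarrow> a \<le> s \<Longrightarrow> 0 \<le> b \<Longrightarrow> b \<le> s \<Longrightarrow> x + a *\<^sub>R u + b *\<^sub>R v \<in> U"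
  obtains a b where "0 < a" "a < s" "0 < b" "b < s"
    "g (x + s *\<^sub>R u + s *\<^sub>R v) - g (x + s *\<^sub>R u) - g (x + s *\<^sub>R v) + g x
       = s * s * frechet_derivative (\<lambda>y. frechet_derivative g (at y) u) (at (x + a *\<^sub>R u + b *\<^sub>R v)) v"
proof -
  have dir: "((\<lambda>t. k (y + t *\<^sub>R w)) has_real_derivative frechet_derivative k (at (y + t *\<^sub>R w)) w) (at t)"
    if k: "smooth_on k U" and yU: "y + t *\<^sub>R w \<in> U" for k :: "'a \<Rightarrow> real" and y w t
  proof -
    let ?k' = "frechet_derivative k (at (y + t *\<^sub>R w))"
    have k': "(k has_derivative ?k') (at (y + t *\<^sub>R w))"
      by (rule smooth_on_has_derivative[OF k yU])
    have "((\<lambda>t. y + t *\<^sub>R w) has_derivative (\<lambda>r. r *\<^sub>R w)) (at t)"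
      by (auto intro!: derivative_eq_intros)
    from diff_chain_at[OF this k'] have "((\<lambda>t. k (y + t *\<^sub>R w)) has_derivative (\<lambda>r. ?k' (r *\<^sub>R w))) (at t)"
      by (simp add: o_def)
    then show ?thesis
      by (simp add: has_field_derivative_def linear_scale[OF has_derivative_linear[OF k']] mult_commute_abs)
  qed
  show ?thesis
  proof (rule second_difference_mvt[OF s, of "\<lambda>a b. g (x + a *\<^sub>R u + b *\<^sub>R v)"
        "\<lambda>a b. frechet_derivative g (at (x + a *\<^sub>R u + b *\<^sub>R v)) u"
        "\<lambda>a b. frechet_derivative (\<lambda>y. frechet_derivative g (at y) u) (at (x + a *\<^sub>R u + b *\<^sub>R v)) v"])
    fix a b :: real assume ab: "0 \<le> a" "a \<le> s" "0 \<le> b" "b \<le> s"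
    show "((\<lambda>a. g (x + a *\<^sub>R u + b *\<^sub>R v)) has_real_derivative
        frechet_derivative g (at (x + a *\<^sub>R u + b *\<^sub>R v)) u) (at a)"
      using dir[OF g, of "x + b *\<^sub>R v" a u] U[OF ab] by (simp add: ac_simps)
    show "((\<lambda>b. frechet_derivative g (at (x + a *\<^sub>R u + b *\<^sub>R v)) u) has_real_derivative
        frechet_derivative (\<lambda>y. frechet_derivative g (at y) u) (at (x + a *\<^sub>R u + b *\<^sub>R v)) v) (at b)"
      by (rule dir[OF smooth_on_frechet_derivative[OF g] U[OF ab]])
  qed (use that in auto)
qed

text \<open>Schwarz's theorem: both mixed derivatives, taken at suitable points near x, equal the
  same second difference divided by the square of s. Continuity brings both points back to x, up to
  e/2 each.\<close>

lemma smooth_on_second_derivative_sym: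
  fixes g :: "'a::real_normed_vector \<Rightarrow> real"
  assumes "open U" "smooth_on g U" "x \<in> U"
  shows "frechet_derivative (\<lambda>y. frechet_derivative g (at y) u) (at x) v
       = frechet_derivative (\<lambda>y. frechet_derivative g (at y) v) (at x) u"
    (is "?A x = ?B x")
proof -
  have cont: "continuous (at x) ?A" "continuous (at x) ?B"
    using assms by (metis continuous_on_eq_continuous_at smooth_on_continuous smooth_on_frechet_derivative)+
  have "dist (?A x) (?B x) \<le> e" if "e > 0" for e
  proof -
    from cont that assms(1,3) obtain d1 d2 d3 where
      "d1 > 0" "\<And>y. dist y x < d1 \<Longrightarrow> dist (?A y) (?A x) < e/2"
      "d2 > 0" "\<And>y. dist y x < d2 \<Longrightarrow> dist (?B y) (?B x) < e/2"
      "d3 > 0" "\<And>y. dist y x < d3 \<Longrightarrow> y \<in> U"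
      unfolding continuous_at_eps_delta open_dist by (metis half_gt_zero)
    then obtain d where d: "d > 0"
      "\<And>y. dist y x < d \<Longrightarrow> dist (?A y) (?A x) < e/2 \<and> dist (?B y) (?B x) < e/2 \<and> y \<in> U"
      using that[of "min d1 (min d2 d3)"] by simp
    \<comment> \<open>With this s the parallelogram spanned by \<open>s *\<^sub>R u\<close> and
      \<open>s *\<^sub>R v\<close> stays within distance d of x. The summand 1 keeps the denominator
      positive when u and v both vanish.\<close>
    define s where "s = d / (2 * (norm u + norm v + 1))"
    have s: "s > 0" using d by (simp add: s_def add_nonneg_pos)
    have near: "dist (x + a *\<^sub>R u + b *\<^sub>R v) x < d" if "0 \<le> a" "a \<le> s" "0 \<le> b" "b \<le> s" for a b
    proof -
      have "dist (x + a *\<^sub>R u + b *\<^sub>R v) x \<le> a * norm u + b * norm v"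
        using norm_triangle_ineq[of "a *\<^sub>R u" "b *\<^sub>R v"] that by (simp add: dist_norm)
      also have "\<dots> \<le> s * norm u + s * norm v"
        using that by (intro add_mono mult_right_mono) auto
      also have "\<dots> < s * (2 * (norm u + norm v + 1))"
        using s by (simp add: distrib_left add_nonneg_pos)
      also have "\<dots> = d" unfolding s_def by (simp add: add_nonneg_eq_0_iff)
      finally show ?thesis .
    qed
    have inU: "x + a *\<^sub>R u + b *\<^sub>R v \<in> U" if "0 \<le> a" "a \<le> s" "0 \<le> b" "b \<le> s" for a b
      using d(2) near[OF that] by blast
    have inU': "x + a *\<^sub>R v + b *\<^sub>R u \<in> U" if "0 \<le> a" "a \<le> s" "0 \<le> b" "b \<le> s" for a b
      using inU[OF that(3,4,1,2)] by (simp add: add.assoc add.commute[of "a *\<^sub>R v"])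
    obtain a b where ab: "0 < a" "a < s" "0 < b" "b < s"
      "g (x + s *\<^sub>R u + s *\<^sub>R v) - g (x + s *\<^sub>R u) - g (x + s *\<^sub>R v) + g x = s * s * ?A (x + a *\<^sub>R u + b *\<^sub>R v)"
      by (rule smooth_on_mixed_difference[OF assms(2) s, of x u v]) (use inU in simp, rule that)
    obtain a' b' where ab': "0 < a'" "a' < s" "0 < b'" "b' < s"
      "g (x + s *\<^sub>R v + s *\<^sub>R u) - g (x + s *\<^sub>R v) - g (x + s *\<^sub>R u) + g x = s * s * ?B (x + a' *\<^sub>R v + b' *\<^sub>R u)"
      by (rule smooth_on_mixed_difference[OF assms(2) s, of x v u]) (use inU' in simp, rule that)
    have "s * s * ?A (x + a *\<^sub>R u + b *\<^sub>R v) = s * s * ?B (x + a' *\<^sub>R v + b' *\<^sub>R u)"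
      unfolding ab(5)[symmetric] ab'(5)[symmetric] by (simp add: ac_simps)
    then have "?A (x + a *\<^sub>R u + b *\<^sub>R v) = ?B (x + b' *\<^sub>R u + a' *\<^sub>R v)"
      using s by (simp add: ac_simps)
    moreover have "dist (?A (x + a *\<^sub>R u + b *\<^sub>R v)) (?A x) < e/2"
      using d(2)[OF near] ab(1-4) by simp
    moreover have "dist (?B (x + b' *\<^sub>R u + a' *\<^sub>R v)) (?B x) < e/2"
      using d(2)[OF near] ab'(1-4) by simp
    ultimately show ?thesis unfolding dist_real_def by linarith
  qed
  then show ?thesis
    by (metis dist_le_zero_iff field_le_epsilon add_0)
qed


section \<open>Smooth maps on a subset and their derivatives along tangent vectors\<close>

text \<open>\<open>smooth_fun_on\<close> covers real-valued functions, but lifts of vector fields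
  are matrix valued; the same notion is therefore set up for general codomains. The extension g is
  an explicit argument because derivatives are computed from it.\<close>

definition local_ext where
  "local_ext M F x g \<longleftrightarrow> (\<exists>U. open U \<and> x \<in> U \<and> smooth_on g U \<and> (\<forall>y\<in>U \<inter> M. g y = F y))"

definition smooth_map_on where
  "smooth_map_on M F \<longleftrightarrow> (\<forall>x\<in>M. \<exists>g. local_ext M F x g)"

(* Only meaningful for v in the tangent space of M at x, where it does not depend on the extension. *)
definition tangent_deriv where
  "tangent_deriv M F x v = frechet_derivative (SOME g. local_ext M F x g) (at x) v"

lemma smooth_fun_on_eq: "smooth_fun_on M \<psi> \<longleftrightarrow> smooth_map_on M \<psi>"
  unfolding smooth_fun_on_def smooth_map_on_def local_ext_def by blast

lemma local_ext_cong: "(\<And>y. y \<in> M \<Longrightarrow> F y = F' y) \<Longrightarrow> local_ext M F = local_ext M F'"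
  unfolding local_ext_def fun_eq_iff by (metis IntD2)

lemma smooth_map_on_cong: "(\<And>y. y \<in> M \<Longrightarrow> F y = F' y) \<Longrightarrow> smooth_map_on M F = smooth_map_on M F'"
  unfolding smooth_map_on_def by (simp add: local_ext_cong[of M F F'])

lemma tangent_deriv_cong: "(\<And>y. y \<in> M \<Longrightarrow> F y = F' y) \<Longrightarrow> tangent_deriv M F = tangent_deriv M F'"
  unfolding tangent_deriv_def fun_eq_iff by (simp add: local_ext_cong[of M F F'])

lemma local_ext_has_derivative:
  "local_ext M F x g \<Longrightarrow> (g has_derivative frechet_derivative g (at x)) (at x)"
  unfolding local_ext_def by (metis smooth_on_has_derivative)

lemma smooth_map_onE:
  assumes "smooth_map_on M F" "x \<in> M"
  obtains U g where "open U" "x \<in> U" "smooth_on g U" "\<forall>y\<in>U \<inter> M. g y = F y"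
  using assms unfolding smooth_map_on_def local_ext_def by meson

lemma local_ext_some: "smooth_map_on M F \<Longrightarrow> x \<in> M \<Longrightarrow> local_ext M F x (SOME g. local_ext M F x g)"
  unfolding smooth_map_on_def by (metis someI_ex)

lemma linear_tangent_deriv: "smooth_map_on M F \<Longrightarrow> x \<in> M \<Longrightarrow> linear (tangent_deriv M F x)"
  using has_derivative_linear[OF local_ext_has_derivative[OF local_ext_some]]
  unfolding tangent_deriv_def by (metis ext)

text \<open>By continuity the curve stays in the domain of g for small times, where g and F agree
  along it. Every extension thus has the same derivative in the direction of a velocity, which makes
  \<open>tangent_deriv\<close> independent of its choice.\<close>

lemma local_ext_curve:
  assumes g: "local_ext M F x g" and c: "smooth_curve_in M c" "c 0 = x" "(c has_vector_derivative v) (at 0)"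
  shows "((\<lambda>t. F (c t)) has_vector_derivative frechet_derivative g (at x) v) (at 0)"
proof -
  obtain U where U: "open U" "x \<in> U" "smooth_on g U" "\<forall>y\<in>U \<inter> M. g y = F y"
    using g unfolding local_ext_def by blast
  have "continuous_on UNIV c" using c(1) by (simp add: smooth_curve_in_def smooth_on_continuous)
  then have op: "open (c -` U)" using U(1) by (simp add: open_vimage)
  have "(c has_derivative (\<lambda>t. t *\<^sub>R v)) (at 0)"
    using c(3) by (simp add: has_vector_derivative_def)
  then have "((g \<circ> c) has_derivative (frechet_derivative g (at x) \<circ> (\<lambda>t. t *\<^sub>R v))) (at 0)"
    by (rule diff_chain_at) (simp add: c(2) local_ext_has_derivative[OF g])
  then have "((\<lambda>t. g (c t)) has_vector_derivative frechet_derivative g (at x) v) (at 0)"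
    by (simp add: o_def has_vector_derivative_def
        linear_scale[OF has_derivative_linear[OF local_ext_has_derivative[OF g]]])
  then show ?thesis
    by (rule has_vector_derivative_transform_within_open[OF _ op])
      (use U c in \<open>auto simp: smooth_curve_in_def\<close>)
qed

lemma tangent_deriv_curve:
  assumes "smooth_map_on M F" "smooth_curve_in M c" "c 0 = x" "(c has_vector_derivative v) (at 0)"
  shows "((\<lambda>t. F (c t)) has_vector_derivative tangent_deriv M F x v) (at 0)"
  unfolding tangent_deriv_def
  using assms by (intro local_ext_curve[OF local_ext_some]) (auto simp: smooth_curve_in_def)

lemma tangent_spaceE:
  assumes "v \<in> tangent_space M x"
  obtains c where "smooth_curve_in M c" "c 0 = x" "(c has_vector_derivative v) (at 0)"
  using assms smooth_on_vector_derivative unfolding tangent_space_def smooth_curve_in_def by blast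

lemma tangent_spaceI:
  assumes "smooth_curve_in M c" "c 0 = x" "(c has_vector_derivative v) (at 0)"
  shows "v \<in> tangent_space M x"
  using assms vector_derivative_at[OF assms(3)] unfolding tangent_space_def by blast

text \<open>Tangency of v supplies a curve, and uniqueness of the derivative along it fixes the
  value. Calculus rules for \<open>tangent_deriv\<close> thereby reduce to those for functions of
  one real variable.\<close>

lemma tangent_derivI:
  assumes "v \<in> tangent_space M x" "smooth_map_on M F"
    and "\<And>c. smooth_curve_in M c \<Longrightarrow> c 0 = x \<Longrightarrow> (c has_vector_derivative v) (at 0) \<Longrightarrow>
      ((\<lambda>t. F (c t)) has_vector_derivative w) (at 0)"
  shows "tangent_deriv M F x v = w"
  using assms tangent_deriv_curve by (metis tangent_spaceE vector_derivative_unique_at)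

lemma tangent_space_base: "v \<in> tangent_space M x \<Longrightarrow> x \<in> M"
  by (metis tangent_spaceE smooth_curve_in_def)

lemma tangent_deriv_ext:
  assumes "v \<in> tangent_space M x" "local_ext M F x g" "smooth_map_on M F"
  shows "tangent_deriv M F x v = frechet_derivative g (at x) v"
  by (rule tangent_derivI[OF assms(1,3)]) (rule local_ext_curve[OF assms(2)])

lemma smooth_map_onI: "open U \<Longrightarrow> M \<subseteq> U \<Longrightarrow> smooth_on F U \<Longrightarrow> smooth_map_on M F"
  unfolding smooth_map_on_def local_ext_def by blast

lemma smooth_map_on_const: "smooth_map_on M (\<lambda>x. c)"
  by (rule smooth_map_onI[of UNIV]) (auto intro: smooth_on_const)

lemma smooth_map_on_ident: "smooth_map_on M (\<lambda>x. x)"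
  by (rule smooth_map_onI[of UNIV]) (auto intro: smooth_on_ident)

lemma local_ext_bounded_linear:
  "bounded_linear L \<Longrightarrow> local_ext M F x g \<Longrightarrow> local_ext M (\<lambda>x. L (F x)) x (\<lambda>x. L (g x))"
  unfolding local_ext_def by (metis smooth_on_bounded_linear)

lemma local_ext_bilinear:
  assumes "bounded_bilinear B" "local_ext M F x f" "local_ext M G x g"
  shows "local_ext M (\<lambda>x. B (F x) (G x)) x (\<lambda>x. B (f x) (g x))"
proof -
  obtain U V where U: "open U" "x \<in> U" "smooth_on f U" "\<forall>y\<in>U \<inter> M. f y = F y"
    and V: "open V" "x \<in> V" "smooth_on g V" "\<forall>y\<in>V \<inter> M. g y = G y"
    using assms unfolding local_ext_def by blast
  have "smooth_on (\<lambda>x. B (f x) (g x)) (U \<inter> V)"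
    by (rule smooth_on_bilinear[OF assms(1)]) (use U V in \<open>auto intro: smooth_on_subset\<close>)
  with U V show ?thesis unfolding local_ext_def by (intro exI[of _ "U \<inter> V"]) auto
qed

lemma local_ext_add:
  assumes "local_ext M F x f" "local_ext M G x g"
  shows "local_ext M (\<lambda>x. F x + G x) x (\<lambda>x. f x + g x)"
proof -
  obtain U V where U: "open U" "x \<in> U" "smooth_on f U" "\<forall>y\<in>U \<inter> M. f y = F y"
    and V: "open V" "x \<in> V" "smooth_on g V" "\<forall>y\<in>V \<inter> M. g y = G y"
    using assms unfolding local_ext_def by blast
  have "smooth_on (\<lambda>x. f x + g x) (U \<inter> V)"
    by (rule smooth_on_add) (use U V in \<open>auto intro: smooth_on_subset\<close>)
  with U V show ?thesis unfolding local_ext_def by (intro exI[of _ "U \<inter> V"]) auto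
qed

lemma local_ext_compose:
  fixes s :: "'a::euclidean_space \<Rightarrow> 'b::euclidean_space"
  assumes s: "local_ext M S x s" and g: "local_ext N F (S x) g" and "x \<in> M" and MN: "S ` M \<subseteq> N"
  shows "local_ext M (\<lambda>x. F (S x)) x (\<lambda>x. g (s x))"
proof -
  obtain U V where U: "open U" "x \<in> U" "smooth_on s U" "\<forall>y\<in>U \<inter> M. s y = S y"
    and V: "open V" "S x \<in> V" "smooth_on g V" "\<forall>y\<in>V \<inter> N. g y = F y"
    using assms unfolding local_ext_def by blast
  \<comment> \<open>The extension s may leave V away from M, so the domain shrinks to the preimage
    of V.\<close>
  let ?W = "U \<inter> s -` V"
  have W: "open ?W"
    using U V by (intro continuous_open_preimage) (auto intro: smooth_on_continuous)
  have "smooth_on (\<lambda>x. g (s x)) ?W"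
    by (rule smooth_on_compose[OF W V(1) _ V(3)]) (use U in \<open>auto intro: smooth_on_subset\<close>)
  with U V W MN \<open>x \<in> M\<close> show ?thesis unfolding local_ext_def
    by (intro exI[of _ ?W]) (auto simp: image_subset_iff)
qed

lemma smooth_map_on_bounded_linear:
  "bounded_linear L \<Longrightarrow> smooth_map_on M F \<Longrightarrow> smooth_map_on M (\<lambda>x. L (F x))"
  unfolding smooth_map_on_def by (metis local_ext_bounded_linear)

lemma smooth_map_on_bilinear:
  "bounded_bilinear B \<Longrightarrow> smooth_map_on M F \<Longrightarrow> smooth_map_on M G \<Longrightarrow> smooth_map_on M (\<lambda>x. B (F x) (G x))"
  unfolding smooth_map_on_def by (metis local_ext_bilinear)

lemma smooth_map_on_add:
  "smooth_map_on M F \<Longrightarrow> smooth_map_on M G \<Longrightarrow> smooth_map_on M (\<lambda>x. F x + G x)"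
  unfolding smooth_map_on_def by (metis local_ext_add)

lemma smooth_map_on_diff:
  "smooth_map_on M F \<Longrightarrow> smooth_map_on M G \<Longrightarrow> smooth_map_on M (\<lambda>x. F x - G x)"
  using smooth_map_on_add[of M F "\<lambda>x. - G x"]
    smooth_map_on_bounded_linear[OF bounded_linear_minus[OF bounded_linear_ident], of M G] by simp

lemma smooth_map_on_sum:
  "(\<And>i. i \<in> I \<Longrightarrow> smooth_map_on M (F i)) \<Longrightarrow> smooth_map_on M (\<lambda>x. \<Sum>i\<in>I. F i x)"
  by (induction I rule: infinite_finite_induct) (auto intro: smooth_map_on_add smooth_map_on_const)

lemma smooth_map_on_compose:
  fixes S :: "'a::euclidean_space \<Rightarrow> 'b::euclidean_space"
  assumes "smooth_map_on M S" "smooth_map_on N F" "S ` M \<subseteq> N"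
  shows "smooth_map_on M (\<lambda>x. F (S x))"
  using assms local_ext_compose unfolding smooth_map_on_def by (metis image_subset_iff)

lemma smooth_map_on_vec:
  fixes F :: "'a::euclidean_space \<Rightarrow> 'b::euclidean_space ^ 'n"
  assumes "\<And>i. smooth_map_on M (\<lambda>x. F x $ i)"
  shows "smooth_map_on M F"
proof -
  have bl: "bounded_linear (axis i :: 'b \<Rightarrow> 'b ^ 'n)" for i
    unfolding linear_conv_bounded_linear[symmetric]
    by (auto intro!: linearI simp: vec_eq_iff axis_def)
  have "smooth_map_on M (\<lambda>x. \<Sum>i\<in>UNIV. axis i (F x $ i))"
    by (intro smooth_map_on_sum smooth_map_on_bounded_linear[OF bl] assms)
  then show ?thesis by (rule smooth_map_on_cong[THEN iffD1, rotated]) (simp add: vec_eq_iff axis_def)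
qed

lemma smooth_map_on_curve:
  assumes "smooth_map_on M F" "smooth_curve_in M c"
  shows "smooth_on (\<lambda>t. F (c t)) UNIV"
proof -
  have "smooth_map_on UNIV (\<lambda>t. F (c t))"
    by (rule smooth_map_on_compose[OF _ assms(1)])
      (use assms(2) in \<open>auto simp: smooth_curve_in_def intro: smooth_map_onI[of UNIV]\<close>)
  \<comment> \<open>Relative to the whole line, a local extension coincides near t with the function
    itself.\<close>
  then have ext: "\<exists>U g. open U \<and> t \<in> U \<and> smooth_on g U \<and> (\<forall>y\<in>U. g y = F (c y))" for t
    unfolding smooth_map_on_def local_ext_def by (metis Int_UNIV_right UNIV_I)
  show ?thesis
    by (rule smooth_on_local) (metis ext smooth_on_cong)
qed

lemma frechet_derivative_field:
  fixes g :: "'a::euclidean_space \<Rightarrow> 'b::real_normed_vector"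
  assumes "smooth_on g U" "x \<in> U"
  shows "frechet_derivative g (at x) v = (\<Sum>b\<in>Basis. (v \<bullet> b) *\<^sub>R frechet_derivative g (at x) b)"
  by (rule linear_euclidean_expand[OF has_derivative_linear[OF smooth_on_has_derivative[OF assms]]])

text \<open>The derivative of g in the direction h is the natural extension, written in a basis so
  that only fixed directions occur. At each point of M in U the map g is an admissible extension of
  F, and tangency of V makes it irrelevant which one \<open>tangent_deriv\<close> picks
  there.\<close>

lemma local_ext_tangent_deriv:
  fixes M :: "('n::finite, 'd::finite) tall set"
  assumes F: "smooth_map_on M F" and VT: "\<And>y. y \<in> M \<Longrightarrow> V y \<in> tangent_space M y"
    and U: "open U" "x \<in> U" "smooth_on g U" "\<forall>y\<in>U \<inter> M. g y = F y"
    and W: "smooth_on h U" "\<forall>y\<in>U \<inter> M. h y = V y"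
  shows "local_ext M (\<lambda>x. tangent_deriv M F x (V x)) x (\<lambda>y. \<Sum>b\<in>Basis. (h y \<bullet> b) *\<^sub>R frechet_derivative g (at y) b)"
    and "smooth_on (\<lambda>y. \<Sum>b\<in>Basis. (h y \<bullet> b) *\<^sub>R frechet_derivative g (at y) b) U"
proof -
  show "smooth_on (\<lambda>y. \<Sum>b\<in>Basis. (h y \<bullet> b) *\<^sub>R frechet_derivative g (at y) b) U"
    by (intro smooth_on_sum smooth_on_bilinear[OF bounded_bilinear_scaleR]
        smooth_on_bounded_linear[OF bounded_linear_inner_left] smooth_on_frechet_derivative U W)
  moreover have "(\<Sum>b\<in>Basis. (h y \<bullet> b) *\<^sub>R frechet_derivative g (at y) b) = tangent_deriv M F y (V y)"
    if "y \<in> U \<inter> M" for y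
  proof -
    have "local_ext M F y g" using U that unfolding local_ext_def by blast
    then have "tangent_deriv M F y (V y) = frechet_derivative g (at y) (V y)"
      using that by (intro tangent_deriv_ext F VT) auto
    then show ?thesis
      using frechet_derivative_field[OF U(3), of y "V y"] that W(2) by simp
  qed
  ultimately show "local_ext M (\<lambda>x. tangent_deriv M F x (V x)) x (\<lambda>y. \<Sum>b\<in>Basis. (h y \<bullet> b) *\<^sub>R frechet_derivative g (at y) b)"
    using U unfolding local_ext_def by blast
qed

lemma smooth_map_on_tangent_deriv:
  fixes M :: "('n::finite, 'd::finite) tall set"
  assumes F: "smooth_map_on M F" and V: "smooth_map_on M V"
    and VT: "\<And>y. y \<in> M \<Longrightarrow> V y \<in> tangent_space M y"
  shows "smooth_map_on M (\<lambda>x. tangent_deriv M F x (V x))"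
  unfolding smooth_map_on_def
proof
  fix x assume "x \<in> M"
  then obtain U g W h where "open U" "x \<in> U" "smooth_on g U" "\<forall>y\<in>U \<inter> M. g y = F y"
    "open W" "x \<in> W" "smooth_on h W" "\<forall>y\<in>W \<inter> M. h y = V y"
    using F V unfolding smooth_map_on_def local_ext_def by meson
  then have "open (U \<inter> W)" "x \<in> U \<inter> W" "smooth_on g (U \<inter> W)" "\<forall>y\<in>U \<inter> W \<inter> M. g y = F y"
    "smooth_on h (U \<inter> W)" "\<forall>y\<in>U \<inter> W \<inter> M. h y = V y"
    by (auto intro: smooth_on_subset)
  then show "\<exists>g. local_ext M (\<lambda>x. tangent_deriv M F x (V x)) x g"
    using local_ext_tangent_deriv(1)[OF F VT] by blast
qed

lemma tangent_deriv_bounded_linear: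
  assumes "v \<in> tangent_space M x" "smooth_map_on M F" "bounded_linear L"
  shows "tangent_deriv M (\<lambda>x. L (F x)) x v = L (tangent_deriv M F x v)"
  by (rule tangent_derivI[OF assms(1) smooth_map_on_bounded_linear[OF assms(3,2)]])
    (rule bounded_linear.has_vector_derivative[OF assms(3) tangent_deriv_curve[OF assms(2)]])

lemma tangent_deriv_bilinear:
  assumes "v \<in> tangent_space M x" "smooth_map_on M F" "smooth_map_on M G" "bounded_bilinear B"
  shows "tangent_deriv M (\<lambda>x. B (F x) (G x)) x v
    = B (F x) (tangent_deriv M G x v) + B (tangent_deriv M F x v) (G x)"
proof (rule tangent_derivI[OF assms(1)])
  fix c assume c: "smooth_curve_in M c" "c 0 = x" "(c has_vector_derivative v) (at 0)"
  show "((\<lambda>t. B (F (c t)) (G (c t))) has_vector_derivative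
      B (F x) (tangent_deriv M G x v) + B (tangent_deriv M F x v) (G x)) (at 0)"
    using bounded_bilinear.has_vector_derivative[OF assms(4) tangent_deriv_curve[OF assms(2) c]
        tangent_deriv_curve[OF assms(3) c]] c(2) by simp
qed (rule smooth_map_on_bilinear[OF assms(4,2,3)])

lemma tangent_deriv_add:
  assumes "v \<in> tangent_space M x" "smooth_map_on M F" "smooth_map_on M G"
  shows "tangent_deriv M (\<lambda>x. F x + G x) x v = tangent_deriv M F x v + tangent_deriv M G x v"
proof (rule tangent_derivI[OF assms(1) smooth_map_on_add[OF assms(2,3)]])
  fix c assume c: "smooth_curve_in M c" "c 0 = x" "(c has_vector_derivative v) (at 0)"
  show "((\<lambda>t. F (c t) + G (c t)) has_vector_derivative
      tangent_deriv M F x v + tangent_deriv M G x v) (at 0)"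
    by (rule has_vector_derivative_add[OF tangent_deriv_curve[OF assms(2) c] tangent_deriv_curve[OF assms(3) c]])
qed

lemma tangent_deriv_diff:
  assumes "v \<in> tangent_space M x" "smooth_map_on M F" "smooth_map_on M G"
  shows "tangent_deriv M (\<lambda>x. F x - G x) x v = tangent_deriv M F x v - tangent_deriv M G x v"
proof (rule tangent_derivI[OF assms(1) smooth_map_on_diff[OF assms(2,3)]])
  fix c assume c: "smooth_curve_in M c" "c 0 = x" "(c has_vector_derivative v) (at 0)"
  show "((\<lambda>t. F (c t) - G (c t)) has_vector_derivative
      tangent_deriv M F x v - tangent_deriv M G x v) (at 0)"
    by (rule has_vector_derivative_diff[OF tangent_deriv_curve[OF assms(2) c] tangent_deriv_curve[OF assms(3) c]])
qed

lemma tangent_deriv_ident: "v \<in> tangent_space M x \<Longrightarrow> tangent_deriv M (\<lambda>x. x) x v = v"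
  by (rule tangent_derivI[OF _ smooth_map_on_ident])

lemma tangent_deriv_const: "v \<in> tangent_space M x \<Longrightarrow> tangent_deriv M (\<lambda>x. c) x v = 0"
  by (rule tangent_derivI[OF _ smooth_map_on_const]) simp_all

(* In a local extension the second-order terms are symmetric in the two fields and cancel. *)
lemma tangent_deriv_bracket:
  fixes M :: "('n::finite, 'd::finite) tall set" and F :: "('n, 'd) tall \<Rightarrow> real"
  assumes F: "smooth_map_on M F" and X: "smooth_map_on M X" and Y: "smooth_map_on M Y"
    and XT: "\<And>y. y \<in> M \<Longrightarrow> X y \<in> tangent_space M y" and YT: "\<And>y. y \<in> M \<Longrightarrow> Y y \<in> tangent_space M y"
    and x: "x \<in> M"
    and T: "tangent_deriv M Y x (X x) - tangent_deriv M X x (Y x) \<in> tangent_space M x"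
  shows "tangent_deriv M (\<lambda>y. tangent_deriv M F y (Y y)) x (X x)
       - tangent_deriv M (\<lambda>y. tangent_deriv M F y (X y)) x (Y x)
       = tangent_deriv M F x (tangent_deriv M Y x (X x) - tangent_deriv M X x (Y x))"
proof -
  obtain U1 g where U1: "open U1" "x \<in> U1" "smooth_on g U1" "\<forall>y\<in>U1 \<inter> M. g y = F y"
    by (rule smooth_map_onE[OF F x])
  obtain U2 a where U2: "open U2" "x \<in> U2" "smooth_on a U2" "\<forall>y\<in>U2 \<inter> M. a y = X y"
    by (rule smooth_map_onE[OF X x])
  obtain U3 b where U3: "open U3" "x \<in> U3" "smooth_on b U3" "\<forall>y\<in>U3 \<inter> M. b y = Y y"
    by (rule smooth_map_onE[OF Y x])
  define U where "U = U1 \<inter> (U2 \<inter> U3)"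
  have U: "open U" "x \<in> U" and g: "smooth_on g U" "\<forall>y\<in>U \<inter> M. g y = F y"
    and a: "smooth_on a U" "\<forall>y\<in>U \<inter> M. a y = X y" and b: "smooth_on b U" "\<forall>y\<in>U \<inter> M. b y = Y y"
    using U1 U2 U3 unfolding U_def by (auto intro: smooth_on_subset)
  let ?g = "\<lambda>y. frechet_derivative g (at y)"
  have ext: "local_ext M F x g" "local_ext M X x a" "local_ext M Y x b"
    using U g a b unfolding local_ext_def by blast+
  \<comment> \<open>Product rule for the derivative of g in the direction w: one term differentiates
    the derivative of g with the direction frozen, the other differentiates the direction.\<close>
  have main: "tangent_deriv M (\<lambda>y. tangent_deriv M F y (W y)) x v
      = (\<Sum>e\<in>Basis. (W x \<bullet> e) * frechet_derivative (\<lambda>y. ?g y e) (at x) v) + ?g x (tangent_deriv M W x v)"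
    if w: "smooth_on w U" "\<forall>y\<in>U \<inter> M. w y = W y" and W: "smooth_map_on M W" "\<And>y. y \<in> M \<Longrightarrow> W y \<in> tangent_space M y"
      and v: "v \<in> tangent_space M x" for w W v
  proof -
    note l = local_ext_tangent_deriv[OF F W(2) U g w]
    have Wx: "w x = W x" using w(2) x U(2) by simp
    have w': "tangent_deriv M W x v = frechet_derivative w (at x) v"
      by (rule tangent_deriv_ext[OF v _ W(1)]) (use U w in \<open>auto simp: local_ext_def\<close>)
    have "((\<lambda>y. \<Sum>e\<in>Basis. (w y \<bullet> e) *\<^sub>R ?g y e) has_derivative
       (\<lambda>v. \<Sum>e\<in>Basis. (w x \<bullet> e) *\<^sub>R frechet_derivative (\<lambda>y. ?g y e) (at x) v
          + (frechet_derivative w (at x) v \<bullet> e) *\<^sub>R ?g x e)) (at x)"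
      by (intro has_derivative_sum has_derivative_scaleR has_derivative_inner_left
          smooth_on_has_derivative[OF w(1) U(2)] smooth_on_has_derivative[OF _ U(2)]
          smooth_on_frechet_derivative g)
    from frechet_derivative_at[OF this, symmetric]
    have "frechet_derivative (\<lambda>y. \<Sum>e\<in>Basis. (w y \<bullet> e) *\<^sub>R ?g y e) (at x) v =
       (\<Sum>e\<in>Basis. (w x \<bullet> e) *\<^sub>R frechet_derivative (\<lambda>y. ?g y e) (at x) v
          + (frechet_derivative w (at x) v \<bullet> e) *\<^sub>R ?g x e)" by simp
    also have "\<dots> = (\<Sum>e\<in>Basis. (W x \<bullet> e) * frechet_derivative (\<lambda>y. ?g y e) (at x) v)
        + ?g x (tangent_deriv M W x v)"
      using frechet_derivative_field[OF g(1) U(2), of "tangent_deriv M W x v"]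
      by (simp add: sum.distrib Wx w')
    finally show ?thesis
      using tangent_deriv_ext[OF v l(1)] smooth_map_on_tangent_deriv[OF F W] by simp
  qed
  have sec: "(\<Sum>e\<in>Basis. (u \<bullet> e) * frechet_derivative (\<lambda>y. ?g y e) (at x) v) =
      frechet_derivative (\<lambda>y. ?g y v) (at x) u" for u v
  proof -
    have "(\<Sum>e\<in>Basis. (u \<bullet> e) * frechet_derivative (\<lambda>y. ?g y e) (at x) v)
      = (\<Sum>e\<in>Basis. (u \<bullet> e) *\<^sub>R frechet_derivative (\<lambda>y. ?g y v) (at x) e)"
      using smooth_on_second_derivative_sym[OF U(1) g(1) U(2)] by simp
    then show ?thesis
      using frechet_derivative_field[OF smooth_on_frechet_derivative[OF g(1)] U(2), of v u] by simp
  qed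
  have lin: "linear (?g x)" by (rule has_derivative_linear[OF smooth_on_has_derivative[OF g(1) U(2)]])
  \<comment> \<open>The derivatives of the two fields need not be tangent separately, so they are
    kept under the derivative of g; only their difference may be passed to
    \<open>tangent_deriv\<close> of F, by \<open>T\<close>.\<close>
  show ?thesis
    using main[OF a X XT YT[OF x]] main[OF b Y YT XT[OF x]] tangent_deriv_ext[OF T ext(1) F]
      smooth_on_second_derivative_sym[OF U(1) g(1) U(2), of "X x" "Y x"]
    by (simp add: linear_diff[OF lin] sec)
qed


section \<open>Matrix algebra\<close>

lemma bounded_linear_of_linear:
  fixes f :: "'a::euclidean_space \<Rightarrow> 'b::real_normed_vector"
  shows "linear f \<Longrightarrow> bounded_linear f"
  by (simp add: linear_conv_bounded_linear)

lemma bounded_bilinear_matrix_mult: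
  "bounded_bilinear ((**) :: real^'k^'m \<Rightarrow> real^'p^'k \<Rightarrow> real^'p^'m)"
proof -
  have "bilinear ((**) :: real^'k^'m \<Rightarrow> real^'p^'k \<Rightarrow> real^'p^'m)"
    unfolding bilinear_def
    by (auto intro!: linearI simp: matrix_matrix_mult_def vec_eq_iff algebra_simps sum.distrib sum_distrib_left)
  then show ?thesis by (simp add: bilinear_conv_bounded_bilinear)
qed

lemma bounded_linear_transpose: "bounded_linear (transpose :: real^'k^'m \<Rightarrow> real^'m^'k)"
  by (intro bounded_linear_of_linear linearI) (auto simp: transpose_def vec_eq_iff)

lemmas matrix_mult_simps =
  bounded_bilinear.add_left[OF bounded_bilinear_matrix_mult]
  bounded_bilinear.add_right[OF bounded_bilinear_matrix_mult]
  bounded_bilinear.diff_left[OF bounded_bilinear_matrix_mult]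
  bounded_bilinear.diff_right[OF bounded_bilinear_matrix_mult]
  bounded_bilinear.minus_left[OF bounded_bilinear_matrix_mult]
  bounded_bilinear.minus_right[OF bounded_bilinear_matrix_mult]
  bounded_bilinear.scaleR_left[OF bounded_bilinear_matrix_mult]
  bounded_bilinear.scaleR_right[OF bounded_bilinear_matrix_mult]
  bounded_bilinear.zero_left[OF bounded_bilinear_matrix_mult]
  bounded_bilinear.zero_right[OF bounded_bilinear_matrix_mult]

lemmas transpose_simps =
  linear_add[OF bounded_linear.linear[OF bounded_linear_transpose]]
  linear_diff[OF bounded_linear.linear[OF bounded_linear_transpose]]
  linear_neg[OF bounded_linear.linear[OF bounded_linear_transpose]]
  linear_scale[OF bounded_linear.linear[OF bounded_linear_transpose]]
  linear_0[OF bounded_linear.linear[OF bounded_linear_transpose]]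
  matrix_transpose_mul transpose_transpose

lemma bounded_linear_blk: "bounded_linear (\<lambda>X. blk X i)"
  by (intro bounded_linear_of_linear linearI) (auto simp: blk_def vec_eq_iff)

lemmas blk_simps =
  linear_add[OF bounded_linear.linear[OF bounded_linear_blk]]
  linear_diff[OF bounded_linear.linear[OF bounded_linear_blk]]
  linear_neg[OF bounded_linear.linear[OF bounded_linear_blk]]
  linear_scale[OF bounded_linear.linear[OF bounded_linear_blk]]
  linear_0[OF bounded_linear.linear[OF bounded_linear_blk]]

lemma blk_mult: "blk (X ** Q) i = blk X i ** Q"
  by (simp add: blk_def matrix_matrix_mult_def vec_eq_iff)

lemma blk_eqI: "(\<And>i. blk X i = blk Y i) \<Longrightarrow> X = Y"
  by (auto simp: blk_def vec_eq_iff)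

lemma blk2_mult_transpose: "blk2 (X ** transpose Y) i j = blk X i ** transpose (blk Y j)"
  by (simp add: blk_def blk2_def matrix_matrix_mult_def transpose_def vec_eq_iff)

lemma transpose_mult_blk: "transpose X ** Y = (\<Sum>i\<in>UNIV. transpose (blk X i) ** blk Y i)"
proof -
  have "(\<Sum>k\<in>UNIV. X $ k $ a * Y $ k $ b) = (\<Sum>i\<in>UNIV. \<Sum>e\<in>UNIV. X $ (i, e) $ a * Y $ (i, e) $ b)" for a b
    by (simp add: sum.cartesian_product flip: UNIV_Times_UNIV)
  then show ?thesis
    by (simp add: blk_def matrix_matrix_mult_def transpose_def vec_eq_iff)
qed

text \<open>Only the diagonal block survives in row block i, so the sum over all columns collapses
  to one block. Statements about the projection thus become identities between d by d
  matrices.\<close>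

lemma blk_symblockdiag_mult:
  fixes M :: "('n::finite, 'd::finite) big" and G :: "('n, 'd) tall"
  shows "blk (symblockdiag M ** G) i = ((1/2) *\<^sub>R (blk2 M i i + transpose (blk2 M i i))) ** blk G i"
proof -
  have sum: "(\<Sum>k\<in>UNIV. (if i = fst k then h (snd k) else 0) * G $ k $ b) = (\<Sum>e\<in>UNIV. h e * G $ (i, e) $ b)"
    for h :: "'d \<Rightarrow> real" and b
  proof -
    have "(\<Sum>k\<in>UNIV. (if i = fst k then h (snd k) else 0) * G $ k $ b)
      = (\<Sum>j\<in>UNIV. \<Sum>e\<in>UNIV. (if i = j then h e else 0) * G $ (j, e) $ b)"
      by (simp add: sum.cartesian_product case_prod_beta flip: UNIV_Times_UNIV)
    also have "\<dots> = (\<Sum>j\<in>UNIV. if i = j then \<Sum>e\<in>UNIV. h e * G $ (j, e) $ b else 0)"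
      by (intro sum.cong) auto
    finally show ?thesis by simp
  qed
  let ?S = "(1/2) *\<^sub>R (blk2 M i i + transpose (blk2 M i i))"
  have "blk (symblockdiag M ** G) i $ a $ b = (?S ** blk G i) $ a $ b" for a b
  proof -
    have "symblockdiag M $ (i, a) $ k = (if i = fst k then ?S $ a $ snd k else 0)" for k
      unfolding symblockdiag_def by simp
    then have "blk (symblockdiag M ** G) i $ a $ b = (\<Sum>k\<in>UNIV. (if i = fst k then ?S $ a $ snd k else 0) * G $ k $ b)"
      by (simp only: blk_def matrix_matrix_mult_def vec_lambda_beta)
    also have "\<dots> = (?S ** blk G i) $ a $ b"
      unfolding sum by (simp only: blk_def matrix_matrix_mult_def vec_lambda_beta)
    finally show ?thesis .
  qed
  then show ?thesis by (simp add: vec_eq_iff)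
qed

section \<open>The Frobenius inner product and its adjoint rules\<close>

lemma inner_matrix: "X \<bullet> Y = trace (transpose X ** Y)" for X Y :: "real^'k^'m"
  by (simp add: inner_vec_def trace_def matrix_matrix_mult_def transpose_def) (rule sum.swap)

lemma frob_inner: "frob X Y = X \<bullet> Y"
  by (simp add: frob_def inner_matrix)

lemma inner_mult_right: "(A ** B) \<bullet> C = A \<bullet> (C ** transpose B)" for A :: "real^'k^'m" and B :: "real^'p^'k"
  by (simp add: inner_matrix matrix_transpose_mul trace_mul_sym[of _ "transpose B"] matrix_mul_assoc[symmetric])
    (metis matrix_mul_assoc trace_mul_sym)

lemma inner_mult_left: "(A ** B) \<bullet> C = B \<bullet> (transpose A ** C)" for A :: "real^'k^'m" and B :: "real^'p^'k"
  by (simp add: inner_matrix matrix_transpose_mul matrix_mul_assoc)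

lemma inner_transpose: "transpose A \<bullet> transpose B = A \<bullet> B" for A :: "real^'k^'m"
  by (simp add: inner_matrix) (metis matrix_transpose_mul trace_mul_sym transpose_transpose inner_commute inner_matrix)

text \<open>Transposition is an isometry that fixes A and negates B, so the inner product equals its
  own negative.\<close>

lemma inner_sym_skew: "transpose A = A \<Longrightarrow> transpose B = - B \<Longrightarrow> A \<bullet> B = 0" for A B :: "real^'k^'k"
  using inner_transpose[of A B] by simp

lemma inner_blk: "X \<bullet> Y = (\<Sum>i\<in>UNIV. blk X i \<bullet> blk Y i)"
proof -
  have "(\<Sum>k\<in>UNIV. X $ k \<bullet> Y $ k) = (\<Sum>i\<in>UNIV. \<Sum>e\<in>UNIV. X $ (i, e) \<bullet> Y $ (i, e))"
    by (simp add: sum.cartesian_product flip: UNIV_Times_UNIV)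
  then show ?thesis by (simp add: inner_vec_def blk_def)
qed


section \<open>Curves of orthogonal matrices\<close>

lemma smooth_on_matrix_mult:
  fixes F :: "'a::real_normed_vector \<Rightarrow> real^'k^'m" and G :: "'a \<Rightarrow> real^'p^'k"
  shows "open U \<Longrightarrow> smooth_on F U \<Longrightarrow> smooth_on G U \<Longrightarrow> smooth_on (\<lambda>x. F x ** G x) U"
  by (rule smooth_on_bilinear[OF bounded_bilinear_matrix_mult])

definition orth_curve :: "real^'d^'d \<Rightarrow> (real \<Rightarrow> real^'d^'d) \<Rightarrow> bool" where
  "orth_curve K R \<longleftrightarrow> smooth_on R UNIV \<and> R 0 = mat 1 \<and> (R has_vector_derivative K) (at 0) \<and>
     (\<forall>t. orthogonal_matrix (R t))"

lemma orth_curve_0: "orth_curve 0 (\<lambda>t. mat 1)"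
  by (auto simp: orth_curve_def smooth_on_const orthogonal_matrix_id)

text \<open>Both curves pass through the identity at time 0, so the product rule there gives the sum
  of the velocities. Realisable velocities are therefore closed under addition even when K and L do
  not commute.\<close>

lemma orth_curve_add: "orth_curve K R \<Longrightarrow> orth_curve L S \<Longrightarrow> orth_curve (K + L) (\<lambda>t. R t ** S t)"
  using bounded_bilinear.has_vector_derivative[OF bounded_bilinear_matrix_mult, of R K 0 UNIV S L]
  by (auto simp: orth_curve_def orthogonal_matrix_mul smooth_on_matrix_mult add.commute)

(* Rodrigues' formula. *)
lemma orth_curve_rotation:
  assumes K: "transpose K = - K" "K ** K ** K = - K"
  shows "orth_curve (a *\<^sub>R K) (\<lambda>t. mat 1 + sin (a * t) *\<^sub>R K + (1 - cos (a * t)) *\<^sub>R (K ** K))"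
proof -
  have K': "K ** (K ** K) = - K" "(K ** K) ** K = - K" "(K ** K) ** (K ** K) = - (K ** K)"
    using K(2) by (simp_all add: matrix_mul_assoc matrix_mult_simps)
  \<comment> \<open>Because the cube of K is -K, the product of this matrix with its transpose
    involves only the identity and the square of K; the coefficient of the latter vanishes by
    \<open>s\<^sup>2 + c\<^sup>2 = 1\<close>.\<close>
  have ort: "orthogonal_matrix (mat 1 + s *\<^sub>R K + (1 - c) *\<^sub>R (K ** K))" if "s\<^sup>2 + c\<^sup>2 = 1" for s c :: real
  proof -
    have "transpose (mat 1 + s *\<^sub>R K + (1 - c) *\<^sub>R (K ** K)) ** (mat 1 + s *\<^sub>R K + (1 - c) *\<^sub>R (K ** K))
      = (mat 1 - s *\<^sub>R K + (1 - c) *\<^sub>R (K ** K)) ** (mat 1 + s *\<^sub>R K + (1 - c) *\<^sub>R (K ** K))"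
      by (simp add: transpose_simps K matrix_mult_simps)
    also have "\<dots> = mat 1 + (2 * (1 - c) - s * s - (1 - c) * (1 - c)) *\<^sub>R (K ** K)"
      by (simp add: matrix_mult_simps K' scaleR_add_left scaleR_diff_left scaleR_add_right scaleR_diff_right algebra_simps)
    also have "2 * (1 - c) - s * s - (1 - c) * (1 - c) = 0"
      using that by (simp add: algebra_simps power2_eq_square)
    finally show ?thesis by (simp add: orthogonal_matrix)
  qed
  have bl: "bounded_linear (\<lambda>t::real. a * t)" by (rule bounded_linear_mult_right)
  have sc: "smooth_on (\<lambda>t. sin (a * t)) UNIV" "smooth_on (\<lambda>t. cos (a * t)) UNIV"
    by (rule smooth_on_compose[OF open_UNIV open_UNIV _ smooth_on_sin_cos(1)]
        smooth_on_compose[OF open_UNIV open_UNIV _ smooth_on_sin_cos(2)];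
        use smooth_on_bounded_linear[OF bl open_UNIV smooth_on_ident[OF open_UNIV]] in simp)+
  have "bounded_linear (\<lambda>t::real. - t)" by (rule bounded_linear_minus[OF bounded_linear_ident])
  from smooth_on_bounded_linear[OF this open_UNIV sc(2)]
  have "smooth_on (\<lambda>t. 1 + - cos (a * t)) UNIV"
    by (intro smooth_on_add smooth_on_const open_UNIV)
  then have "smooth_on (\<lambda>t. mat 1 + sin (a * t) *\<^sub>R K + (1 - cos (a * t)) *\<^sub>R (K ** K)) UNIV"
    by (intro smooth_on_add smooth_on_bounded_linear[OF bounded_linear_scaleR_left] smooth_on_const sc open_UNIV) simp_all
  moreover have "((\<lambda>t. mat 1 + sin (a * t) *\<^sub>R K + (1 - cos (a * t)) *\<^sub>R (K ** K)) has_vector_derivative a *\<^sub>R K) (at 0)"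
    by (auto intro!: derivative_eq_intros simp: has_real_derivative_iff_has_vector_derivative[symmetric])
  ultimately show ?thesis
    using ort by (auto simp: orth_curve_def)
qed

text \<open>The matrices \<open>E i j\<close> generate the rotations of coordinate planes and
  satisfy the cubic equation of Rodrigues' formula. They span the skew matrices, and multiplying the
  corresponding rotations adds up the velocities.\<close>

lemma skew_has_orth_curve:
  fixes K :: "real^'d^'d"
  assumes "transpose K = - K"
  shows "\<exists>R. orth_curve K R"
proof -
  define E :: "'d \<Rightarrow> 'd \<Rightarrow> real^'d^'d" where
    "E i j = (\<chi> a b. of_bool (a = i \<and> b = j) - of_bool (a = j \<and> b = i))" for i j
  have EB: "E i j ** B = (\<chi> a b. of_bool (a = i) * B $ j $ b - of_bool (a = j) * B $ i $ b)" for i j and B :: "real^'d^'d"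
  proof -
    have "(\<Sum>k\<in>UNIV. of_bool (a = i \<and> k = j) * B $ k $ b) = of_bool (a = i) * B $ j $ b" for a b i j
      by (cases "a = i") (simp_all add: of_bool_def if_distrib[of "\<lambda>x. x * _"] cong: if_cong)
    then show ?thesis
      by (simp add: E_def matrix_matrix_mult_def vec_eq_iff left_diff_distrib sum_subtractf)
  qed
  have E3: "E i j ** E i j ** E i j = - E i j" if "i \<noteq> j" for i j
  proof -
    have "E i j ** (E i j ** E i j) = - E i j"
      unfolding EB using that by (auto simp: E_def vec_eq_iff)
    then show ?thesis by (simp add: matrix_mul_assoc)
  qed
  have ET: "transpose (E i j) = - E i j" for i j
    by (simp add: E_def transpose_def vec_eq_iff conj_commute)
  have P: "\<exists>R. orth_curve (r *\<^sub>R E i j) R" for r i j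
  proof (cases "i = j")
    case True
    then have "E i j = 0" by (simp add: E_def vec_eq_iff)
    then show ?thesis using orth_curve_0 by auto
  qed (use orth_curve_rotation[OF ET E3] in blast)
  have S: "\<exists>R. orth_curve (\<Sum>x\<in>I. L x) R" if "\<And>x. \<exists>R. orth_curve (L x) R" for I and L :: "'z \<Rightarrow> real^'d^'d"
    by (induction I rule: infinite_finite_induct) (use that orth_curve_0 orth_curve_add in fastforce)+
  \<comment> \<open>Each pair of indices is counted twice, since both K and \<open>E\<close> change
    sign when the indices are swapped; hence the division by 2.\<close>
  have "K = (\<Sum>i\<in>UNIV. \<Sum>j\<in>UNIV. (K $ i $ j / 2) *\<^sub>R E i j)"
  proof -
    have skew: "K $ b $ a = - K $ a $ b" for a b
      using arg_cong[OF assms, of "\<lambda>M. M $ a $ b"] by (simp add: transpose_def)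
    have sum: "(\<Sum>i\<in>UNIV. \<Sum>j\<in>UNIV. K $ i $ j / 2 * of_bool (a = i \<and> b = j)) = K $ a $ b / 2" for a b
    proof -
      have "(\<Sum>j\<in>UNIV. K $ i $ j / 2 * of_bool (a = i \<and> b = j)) = (if a = i then K $ i $ b / 2 else 0)" for i
        by (simp add: of_bool_def if_distrib[of "\<lambda>x. _ * x"] cong: if_cong)
      then show ?thesis by simp
    qed
    have "(\<Sum>i\<in>UNIV. \<Sum>j\<in>UNIV. (K $ i $ j / 2) *\<^sub>R E i j) $ a $ b = K $ a $ b" for a b
    proof -
      have "(\<Sum>i\<in>UNIV. \<Sum>j\<in>UNIV. (K $ i $ j / 2) *\<^sub>R E i j) $ a $ b =
        (\<Sum>i\<in>UNIV. \<Sum>j\<in>UNIV. K $ i $ j / 2 * of_bool (a = i \<and> b = j))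
        - (\<Sum>i\<in>UNIV. \<Sum>j\<in>UNIV. K $ i $ j / 2 * of_bool (b = i \<and> a = j))"
        by (simp add: E_def right_diff_distrib sum_subtractf conj_commute)
      also have "\<dots> = K $ a $ b" unfolding sum skew[of b a] by simp
      finally show ?thesis .
    qed
    then show ?thesis by (simp add: vec_eq_iff)
  qed
  moreover have "\<exists>R. orth_curve (\<Sum>i\<in>UNIV. \<Sum>j\<in>UNIV. (K $ i $ j / 2) *\<^sub>R E i j) R"
    by (intro S P)
  ultimately show ?thesis by metis
qed


section \<open>Geometry of the product of orthogonal groups\<close>

abbreviation tanO :: "('n::finite, 'd::finite) tall \<Rightarrow> ('n, 'd) tall set" where
  "tanO G \<equiv> tangent_space orth_prod G"

lemma orth_prod_blk:
  assumes "G \<in> orth_prod"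
  shows "blk G i ** transpose (blk G i) = mat 1" "transpose (blk G i) ** blk G i = mat 1"
  using assms by (auto simp: orth_prod_def orthogonal_matrix_def)

lemma orth_prod_gram:
  fixes G :: "('n::finite, 'd::finite) tall"
  assumes "G \<in> orth_prod"
  shows "transpose G ** G = real CARD('n) *\<^sub>R mat 1"
  by (simp add: transpose_mult_blk orth_prod_blk[OF assms] flip: sum_constant_scaleR)

lemma orth_prod_mult: "G \<in> orth_prod \<Longrightarrow> orthogonal_matrix Q \<Longrightarrow> G ** Q \<in> orth_prod"
  by (simp add: orth_prod_def blk_mult orthogonal_matrix_mul)

definition place_blk :: "'n::finite \<Rightarrow> real^'d^'d \<Rightarrow> ('n, 'd::finite) tall" where
  "place_blk i A = (\<chi> r. if fst r = i then A $ snd r else 0)"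

lemma bounded_linear_place_blk: "bounded_linear (place_blk i)"
  by (intro bounded_linear_of_linear linearI) (auto simp: place_blk_def vec_eq_iff)

lemma blk_sum_place_blk: "blk (\<Sum>j\<in>UNIV. place_blk j (A j)) i = A i"
proof -
  have "(\<Sum>j\<in>UNIV. (if i = j then A j $ a else 0) $ b) = A i $ a $ b" for a b
    by (simp add: if_distrib[of "\<lambda>x. x $ b"] cong: if_cong)
  then show ?thesis by (simp add: blk_def place_blk_def vec_eq_iff)
qed

text \<open>One direction differentiates the equation saying that block times transposed block is
  the identity. In the other, \<open>blk W i ** transpose (blk G i)\<close> is skew, and rotating
  each block of G from the left by a curve with this velocity stays in the product of orthogonal
  groups.\<close>

lemma tangent_orth_prod:
  "W \<in> tanO G \<longleftrightarrow>
    G \<in> orth_prod \<and> (\<forall>i. blk W i ** transpose (blk G i) + blk G i ** transpose (blk W i) = 0)"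
proof
  assume W: "W \<in> tanO G"
  then obtain c where c: "smooth_curve_in orth_prod c" "c 0 = G" "(c has_vector_derivative W) (at 0)"
    by (rule tangent_spaceE)
  have "blk W i ** transpose (blk G i) + blk G i ** transpose (blk W i) = 0" for i
  proof -
    have b: "((\<lambda>t. blk (c t) i) has_vector_derivative blk W i) (at 0)"
      by (rule bounded_linear.has_vector_derivative[OF bounded_linear_blk c(3)])
    have "((\<lambda>t. blk (c t) i ** transpose (blk (c t) i)) has_vector_derivative
        blk (c 0) i ** transpose (blk W i) + blk W i ** transpose (blk (c 0) i)) (at 0)"
      by (rule bounded_bilinear.has_vector_derivative[OF bounded_bilinear_matrix_mult b
            bounded_linear.has_vector_derivative[OF bounded_linear_transpose b]])
    moreover have "blk (c t) i ** transpose (blk (c t) i) = mat 1" for t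
      using c(1) by (simp add: smooth_curve_in_def orth_prod_blk)
    ultimately have "blk (c 0) i ** transpose (blk W i) + blk W i ** transpose (blk (c 0) i) = 0"
      using vector_derivative_unique_at[OF _ has_vector_derivative_const, of "mat 1"] by simp
    then show ?thesis by (simp add: c(2) add.commute)
  qed
  then show "G \<in> orth_prod \<and> (\<forall>i. blk W i ** transpose (blk G i) + blk G i ** transpose (blk W i) = 0)"
    using tangent_space_base[OF W] by blast
next
  assume *: "G \<in> orth_prod \<and> (\<forall>i. blk W i ** transpose (blk G i) + blk G i ** transpose (blk W i) = 0)"
  then have G: "G \<in> orth_prod" by blast
  have "transpose (blk W i ** transpose (blk G i)) = - (blk W i ** transpose (blk G i))" for i
    using * by (simp add: transpose_simps add_eq_0_iff)
  then have "\<forall>i. \<exists>R. orth_curve (blk W i ** transpose (blk G i)) R"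
    using skew_has_orth_curve by blast
  then obtain R where R: "\<And>i. orth_curve (blk W i ** transpose (blk G i)) (R i)" by metis
  define c where "c t = (\<Sum>i\<in>UNIV. place_blk i (R i t ** blk G i))" for t
  have "c t \<in> orth_prod" for t
    using R G by (simp add: orth_prod_def c_def blk_sum_place_blk orth_curve_def orthogonal_matrix_mul)
  moreover have "smooth_on c UNIV"
    unfolding c_def using R
    by (intro smooth_on_sum smooth_on_bounded_linear[OF bounded_linear_place_blk] smooth_on_matrix_mult
        smooth_on_const) (auto simp: orth_curve_def)
  moreover have "c 0 = G"
    by (rule blk_eqI) (use R in \<open>simp add: c_def blk_sum_place_blk orth_curve_def\<close>)
  moreover have "(c has_vector_derivative W) (at 0)"
  proof -
    have "((\<lambda>t. R i t ** blk G i) has_vector_derivative blk W i) (at 0)" for i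
      using bounded_linear.has_vector_derivative[OF bounded_bilinear.bounded_linear_left[OF bounded_bilinear_matrix_mult], of "R i" "blk W i ** transpose (blk G i)" "at 0" "blk G i"]
        R[of i] by (simp add: orth_curve_def matrix_mul_assoc[symmetric] orth_prod_blk[OF G])
    then have "(c has_vector_derivative (\<Sum>i\<in>UNIV. place_blk i (blk W i))) (at 0)"
      unfolding c_def
      by (intro has_vector_derivative_sum bounded_linear.has_vector_derivative[OF bounded_linear_place_blk])
    moreover have "(\<Sum>i\<in>UNIV. place_blk i (blk W i)) = W"
      by (rule blk_eqI) (simp add: blk_sum_place_blk)
    ultimately show ?thesis by simp
  qed
  ultimately show "W \<in> tanO G"
    by (intro tangent_spaceI[of _ c]) (auto simp: smooth_curve_in_def)
qed

lemma subspace_tangent: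
  assumes "G \<in> orth_prod"
  shows "subspace (tanO G)"
proof (rule subspaceI)
  let ?t = "\<lambda>W i. blk W i ** transpose (blk G i) + blk G i ** transpose (blk W i)"
  show "0 \<in> tanO G"
    using assms by (simp add: tangent_orth_prod blk_simps matrix_mult_simps transpose_simps)
  show "x + y \<in> tanO G" if "x \<in> tanO G" "y \<in> tanO G" for x y
  proof -
    have "?t (x + y) i = ?t x i + ?t y i" for i
      by (simp add: blk_simps matrix_mult_simps transpose_simps algebra_simps)
    then show ?thesis using that by (simp add: tangent_orth_prod)
  qed
  show "r *\<^sub>R x \<in> tanO G" if "x \<in> tanO G" for r x
  proof -
    have "?t (r *\<^sub>R x) i = r *\<^sub>R ?t x i" for i
      by (simp add: blk_simps matrix_mult_simps transpose_simps algebra_simps)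
    then show ?thesis using that by (simp add: tangent_orth_prod)
  qed
qed

lemma tangent_mult_skew:
  assumes "G \<in> orth_prod" "transpose K = - K"
  shows "G ** K \<in> tanO G"
  using assms by (auto simp: tangent_orth_prod blk_mult transpose_simps matrix_mult_simps matrix_mul_assoc)

text \<open>Tangency says that \<open>blk W i ** transpose (blk G i)\<close> is skew. Conjugation by
  the orthogonal block turns this into skewness of \<open>transpose (blk G i) ** blk W i\<close>,
  and \<open>transpose G ** W\<close> is the sum of these products.\<close>

lemma tangent_gram_skew:
  assumes "W \<in> tanO G"
  shows "transpose (transpose G ** W) = - (transpose G ** W)"
proof -
  have G: "G \<in> orth_prod" and W: "blk G i ** transpose (blk W i) = - (blk W i ** transpose (blk G i))" for i
    using assms by (auto simp: tangent_orth_prod add_eq_0_iff)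
  have "transpose (blk W i) ** blk G i = - (transpose (blk G i) ** blk W i)" for i
  proof -
    have "transpose (blk W i) ** blk G i = transpose (blk G i) ** (blk G i ** transpose (blk W i)) ** blk G i"
      by (simp add: matrix_mul_assoc orth_prod_blk[OF G])
    also have "\<dots> = - (transpose (blk G i) ** blk W i ** (transpose (blk G i) ** blk G i))"
      unfolding W by (simp only: matrix_mult_simps matrix_mul_assoc)
    finally show ?thesis by (simp add: orth_prod_blk[OF G])
  qed
  then have "transpose W ** G = - (transpose G ** W)"
    by (simp add: transpose_mult_blk[of W] transpose_mult_blk[of G] sum_negf)
  then show ?thesis by (simp add: transpose_simps)
qed

section \<open>Orthogonal projection onto the tangent space\<close>

definition tproj :: "('n::finite, 'd::finite) tall \<Rightarrow> ('n, 'd) tall \<Rightarrow> ('n, 'd) tall" where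
  "tproj G W = W - symblockdiag (W ** transpose G) ** G"

lemma blk_tproj:
  "blk (tproj G W) i = blk W i - ((1/2) *\<^sub>R (blk W i ** transpose (blk G i) + blk G i ** transpose (blk W i))) ** blk G i"
  by (simp add: tproj_def blk_simps blk_symblockdiag_mult blk2_mult_transpose transpose_simps)

lemma tproj_tangent:
  assumes "G \<in> orth_prod"
  shows "tproj G W \<in> tanO G"
proof -
  have "blk (tproj G W) i ** transpose (blk G i)
     = blk W i ** transpose (blk G i) - (1/2) *\<^sub>R (blk W i ** transpose (blk G i) + blk G i ** transpose (blk W i))" for i
    by (simp add: blk_tproj matrix_mult_simps matrix_mul_assoc[symmetric] orth_prod_blk[OF assms])
  then have *: "blk (tproj G W) i ** transpose (blk G i)
     = (1/2) *\<^sub>R (blk W i ** transpose (blk G i) - blk G i ** transpose (blk W i))" for i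
    by (simp add: vec_eq_iff field_simps)
  have "blk G i ** transpose (blk (tproj G W) i) = transpose (blk (tproj G W) i ** transpose (blk G i))" for i
    by (simp add: transpose_simps)
  then show ?thesis
    using assms by (simp add: tangent_orth_prod * transpose_simps flip: scaleR_add_right)
qed

text \<open>Moving the block of G to the other side pairs the symmetric \<open>A i\<close> with the
  skew matrix \<open>blk V i ** transpose (blk G i)\<close>. Symmetric block diagonal multiples of G
  are therefore normal.\<close>

lemma inner_blockdiag_tangent:
  assumes "V \<in> tanO G" "\<And>i. blk X i = A i ** blk G i" "\<And>i. transpose (A i) = A i"
  shows "X \<bullet> V = 0"
proof -
  have "blk X i \<bullet> blk V i = 0" for i
    unfolding assms(2) inner_mult_right
    by (rule inner_sym_skew[OF assms(3)]) (use assms(1) in \<open>simp add: tangent_orth_prod transpose_simps add_eq_0_iff\<close>)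
  then show ?thesis by (simp add: inner_blk)
qed

lemma inner_tproj:
  assumes "V \<in> tanO G"
  shows "(W - tproj G W) \<bullet> V = 0"
  by (rule inner_blockdiag_tangent[OF assms, of _ "\<lambda>i. (1/2) *\<^sub>R (blk W i ** transpose (blk G i) + blk G i ** transpose (blk W i))"])
    (simp_all add: blk_tproj blk_simps transpose_simps add.commute)

lemma orth_proj_tangent:
  assumes "G \<in> orth_prod"
  shows "orth_proj (tanO G) W = tproj G W"
  unfolding orth_proj_def
proof (rule the_equality)
  show "tproj G W \<in> tanO G \<and> (\<forall>V\<in>tanO G. frob (W - tproj G W) V = 0)"
    using tproj_tangent[OF assms] inner_tproj by (auto simp: frob_inner)
next
  fix P assume P: "P \<in> tanO G \<and> (\<forall>V\<in>tanO G. frob (W - P) V = 0)"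
  let ?D = "P - tproj G W"
  have D: "?D \<in> tanO G" using P tproj_tangent[OF assms] subspace_tangent[OF assms] by (auto intro: subspace_diff)
  have "?D \<bullet> ?D = (W - tproj G W) \<bullet> ?D - (W - P) \<bullet> ?D" by (simp add: inner_diff_left)
  also have "\<dots> = 0" using P D inner_tproj[OF D] by (simp add: frob_inner)
  finally show "P = tproj G W" by simp
qed

text \<open>Recognises the projection from a splitting into a tangent and a normal part: the
  difference of two candidates is tangent and orthogonal to itself.\<close>

lemma tproj_eqI:
  assumes "V \<in> tanO G" "\<And>i. blk (W - V) i = A i ** blk G i" "\<And>i. transpose (A i) = A i"
  shows "tproj G W = V"
proof -
  have G: "G \<in> orth_prod" by (rule tangent_space_base[OF assms(1)])
  let ?D = "V - tproj G W"
  have D: "?D \<in> tanO G" using assms(1) tproj_tangent[OF G] subspace_tangent[OF G] by (auto intro: subspace_diff)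
  have "?D \<bullet> ?D = (W - tproj G W) \<bullet> ?D - (W - V) \<bullet> ?D" by (simp add: inner_diff_left)
  also have "\<dots> = 0" using inner_tproj[OF D] inner_blockdiag_tangent[OF D assms(2,3)] by simp
  finally show ?thesis by simp
qed

lemma tproj_id: "V \<in> tanO G \<Longrightarrow> tproj G V = V"
  by (rule tproj_eqI[where A = "\<lambda>i. 0"]) (simp_all add: blk_simps matrix_mult_simps transpose_simps)

lemma linear_symblockdiag: "linear symblockdiag"
  by (intro linearI) (auto simp: symblockdiag_def blk2_def transpose_def vec_eq_iff algebra_simps)

lemma linear_tproj: "linear (tproj G)"
  by (intro linearI)
    (simp_all add: tproj_def matrix_mult_simps linear_add[OF linear_symblockdiag]
      linear_scale[OF linear_symblockdiag] algebra_simps)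


subsection \<open>Horizontal vectors\<close>

text \<open>This is the operator on the right-hand side of the theorem with the product regrouped.
  The subtracted term is the vertical component of the tangent projection; its factor compensates
  for \<open>transpose G ** G\<close> being n times the identity.\<close>

definition hproj :: "('n::finite, 'd::finite) tall \<Rightarrow> ('n, 'd) tall \<Rightarrow> ('n, 'd) tall" where
  "hproj G W = tproj G W - (1 / real CARD('n)) *\<^sub>R (G ** (transpose G ** tproj G W))"

lemma mem_quot: "G' \<in> quot G \<longleftrightarrow> (\<exists>Q. orthogonal_matrix Q \<and> G' = G ** Q)"
  by (auto simp: quot_def)

lemma quot_mult: "orthogonal_matrix Q \<Longrightarrow> quot (G ** Q) = quot G"
proof -
  assume Q: "orthogonal_matrix Q"
  have "\<exists>Q''. orthogonal_matrix Q'' \<and> G ** Q ** Q' = G ** Q''" if "orthogonal_matrix Q'" for Q'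
    using Q that by (metis matrix_mul_assoc orthogonal_matrix_mul)
  moreover have "\<exists>Q''. orthogonal_matrix Q'' \<and> G ** Q' = G ** Q ** Q''" if "orthogonal_matrix Q'" for Q'
    using Q that
    by (intro exI[of _ "transpose Q ** Q'"])
      (metis matrix_mul_assoc matrix_mul_lid orthogonal_matrix_def orthogonal_matrix_mul orthogonal_matrix_transpose)
  ultimately show ?thesis by (auto simp: mem_quot set_eq_iff)
qed

lemma self_mem_quot: "G \<in> quot G"
  unfolding mem_quot by (metis matrix_mul_rid orthogonal_matrix_id)

lemma quot_eq_iff: "quot G = quot G' \<longleftrightarrow> (\<exists>Q. orthogonal_matrix Q \<and> G' = G ** Q)"
  by (metis mem_quot quot_mult self_mem_quot)

lemma vertical_curve:
  assumes "G \<in> orth_prod" "orth_curve K R"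
  shows "smooth_curve_in {G' \<in> orth_prod. quot G' = quot G} (\<lambda>t. G ** R t)"
    "((\<lambda>t. G ** R t) has_vector_derivative G ** K) (at 0)" "G ** R 0 = G"
  using assms bounded_linear.has_vector_derivative[OF bounded_bilinear.bounded_linear_right[OF bounded_bilinear_matrix_mult], of R K "at 0" G]
  by (auto simp: orth_curve_def smooth_curve_in_def orth_prod_mult quot_mult smooth_on_matrix_mult smooth_on_const)

lemma smooth_curve_in_subset: "smooth_curve_in M c \<Longrightarrow> M \<subseteq> N \<Longrightarrow> smooth_curve_in N c"
  by (auto simp: smooth_curve_in_def)

text \<open>A curve in the fibre is G times an orthogonal matrix chosen separately at each time.
  Instead of differentiating that factor, the proof differentiates
  \<open>c t ** transpose (c t)\<close>, which is constant along the fibre; multiplying the result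
  by G recovers n w as G times a skew matrix.\<close>

lemma vertical_space_eq:
  fixes G :: "('n::finite, 'd::finite) tall"
  assumes G: "G \<in> orth_prod"
  shows "vertical_space G = {G ** K | K. transpose K = - K}"
proof (intro equalityI subsetI)
  fix w assume "w \<in> {G ** K | K. transpose K = - K}"
  then obtain K where K: "w = G ** K" "transpose K = - K" by blast
  then obtain R where "orth_curve K R" using skew_has_orth_curve by blast
  from vertical_curve[OF G this] K show "w \<in> vertical_space G"
    unfolding vertical_space_def by (auto intro: tangent_spaceI)
next
  fix w assume "w \<in> vertical_space G"
  then obtain c where c: "smooth_curve_in {G' \<in> orth_prod. quot G' = quot G} c" "c 0 = G"
      "(c has_vector_derivative w) (at 0)"
    unfolding vertical_space_def by (rule tangent_spaceE)
  have wT: "w \<in> tanO G"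
    by (rule tangent_spaceI[OF smooth_curve_in_subset[OF c(1)] c(2,3)]) auto
  have "c t ** transpose (c t) = G ** transpose G" for t
  proof -
    have "quot G = quot (c t)" using c(1) by (auto simp: smooth_curve_in_def)
    then obtain Q where "orthogonal_matrix Q" "c t = G ** Q" unfolding quot_eq_iff by blast
    then show ?thesis
      by (simp add: matrix_transpose_mul orthogonal_matrix_def matrix_mul_assoc) (metis matrix_mul_assoc matrix_mul_rid)
  qed
  moreover have "((\<lambda>t. c t ** transpose (c t)) has_vector_derivative
      c 0 ** transpose w + w ** transpose (c 0)) (at 0)"
    by (rule bounded_bilinear.has_vector_derivative[OF bounded_bilinear_matrix_mult c(3)
          bounded_linear.has_vector_derivative[OF bounded_linear_transpose c(3)]])
  ultimately have "G ** transpose w + w ** transpose G = 0"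
    using vector_derivative_unique_at[OF _ has_vector_derivative_const, of "G ** transpose G"] c(2) by simp
  then have "(G ** transpose w + w ** transpose G) ** G = 0" by (simp add: matrix_mult_simps)
  then have "real CARD('n) *\<^sub>R w = - (G ** (transpose w ** G))"
    by (simp add: matrix_mult_simps matrix_mul_assoc[symmetric] orth_prod_gram[OF G] add_eq_0_iff)
  moreover have tw: "transpose w ** G = - (transpose G ** w)"
    using tangent_gram_skew[OF wT] by (simp add: transpose_simps)
  ultimately have "real CARD('n) *\<^sub>R w = G ** (transpose G ** w)"
    by (simp add: matrix_mult_simps)
  then have "w = (1 / real CARD('n)) *\<^sub>R (G ** (transpose G ** w))"
    by (metis (no_types, lifting) divideR_right inverse_eq_divide of_nat_0_less_iff order_less_irrefl zero_less_card_finite)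
  then have "w = G ** ((1 / real CARD('n)) *\<^sub>R (transpose G ** w))"
    by (simp add: matrix_mult_simps)
  moreover have "transpose ((1 / real CARD('n)) *\<^sub>R (transpose G ** w)) = - ((1 / real CARD('n)) *\<^sub>R (transpose G ** w))"
    using tangent_gram_skew[OF wT] by (simp only: transpose_scalar) simp
  ultimately show "w \<in> {G ** K | K. transpose K = - K}" by blast
qed

text \<open>The vector \<open>G ** (transpose G ** v)\<close> is vertical, and testing v against it
  yields the squared norm of \<open>transpose G ** v\<close>. Conversely, moving G across the inner
  product settles every vertical vector \<open>G ** K\<close>.\<close>

lemma horizontal_space_eq:
  assumes G: "G \<in> orth_prod"
  shows "v \<in> horizontal_space G \<longleftrightarrow> v \<in> tanO G \<and> transpose G ** v = 0"
proof -
  have "transpose G ** v = 0" if "v \<in> tanO G" "\<forall>w\<in>vertical_space G. frob v w = 0"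
  proof -
    have "G ** (transpose G ** v) \<in> vertical_space G"
      using tangent_gram_skew[OF that(1)] by (auto simp: vertical_space_eq[OF G])
    then have "(G ** (transpose G ** v)) \<bullet> v = 0"
      using that(2) by (metis frob_inner inner_commute)
    then show ?thesis by (metis inner_mult_left inner_eq_zero_iff)
  qed
  moreover have "frob v w = 0" if v: "transpose G ** v = 0" and w: "w \<in> vertical_space G" for w
  proof -
    obtain K where "w = G ** K" using w by (auto simp: vertical_space_eq[OF G])
    then show ?thesis using v by (simp add: frob_inner inner_commute[of v] inner_mult_left)
  qed
  ultimately show ?thesis unfolding horizontal_space_def by blast
qed

lemma subspace_horizontal: "G \<in> orth_prod \<Longrightarrow> subspace (horizontal_space G)"
  using subspace_tangent[of G]
  by (auto simp: subspace_def horizontal_space_eq matrix_mult_simps)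

lemma linear_hproj: "linear (hproj G)"
  by (intro linearI)
    (simp_all add: hproj_def linear_add[OF linear_tproj] linear_scale[OF linear_tproj] matrix_mult_simps algebra_simps)

lemma hproj_horizontal:
  fixes G :: "('n::finite, 'd::finite) tall"
  assumes G: "G \<in> orth_prod"
  shows "hproj G W \<in> horizontal_space G"
proof -
  have "transpose G ** hproj G W = 0"
    by (simp add: hproj_def matrix_mult_simps matrix_mul_assoc orth_prod_gram[OF G])
  moreover have "G ** (transpose G ** tproj G W) \<in> tanO G"
    by (intro tangent_mult_skew[OF G] tangent_gram_skew tproj_tangent[OF G])
  then have "hproj G W \<in> tanO G"
    unfolding hproj_def using subspace_tangent[OF G] tproj_tangent[OF G]
    by (metis subspace_diff subspace_scale)
  ultimately show ?thesis by (simp add: horizontal_space_eq[OF G])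
qed

lemma hproj_id: "G \<in> orth_prod \<Longrightarrow> v \<in> horizontal_space G \<Longrightarrow> hproj G v = v"
  by (simp add: hproj_def horizontal_space_eq tproj_id matrix_mult_simps)

text \<open>What \<open>hproj\<close> removes is normal or vertical, hence orthogonal to Z. For
  metric compatibility this lets the projection be inserted into the product rule at no
  cost.\<close>

lemma inner_hproj:
  assumes G: "G \<in> orth_prod" and Z: "Z \<in> horizontal_space G"
  shows "hproj G W \<bullet> Z = W \<bullet> Z"
proof -
  have ZT: "Z \<in> tanO G" "transpose G ** Z = 0" using Z by (auto simp: horizontal_space_eq[OF G])
  have "tproj G W \<bullet> Z = W \<bullet> Z" using inner_tproj[OF ZT(1), of W] by (simp add: inner_diff_left)
  moreover have "(G ** (transpose G ** tproj G W)) \<bullet> Z = 0"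
    by (simp add: inner_mult_left[of G] ZT)
  ultimately show ?thesis by (simp add: hproj_def inner_diff_left)
qed

lemma hproj_tangent_diff:
  fixes G :: "('n::finite, 'd::finite) tall"
  assumes "w \<in> tanO G"
  shows "\<exists>K. transpose K = - K \<and> w = hproj G w + G ** K"
  using tangent_gram_skew[OF assms]
  by (intro exI[of _ "(1 / real CARD('n)) *\<^sub>R (transpose G ** w)"])
    (simp add: hproj_def tproj_id[OF assms] matrix_mult_simps transpose_scalar)

lemma horizontal_tangent: "v \<in> horizontal_space G \<Longrightarrow> v \<in> tanO G"
  by (simp add: horizontal_space_def)


section \<open>The quotient\<close>

abbreviation smO :: "(('n::finite, 'd::finite) tall \<Rightarrow> 'b::real_normed_vector) \<Rightarrow> bool" where
  "smO F \<equiv> smooth_map_on orth_prod F"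

abbreviation tdO :: "(('n::finite, 'd::finite) tall \<Rightarrow> 'b::real_normed_vector) \<Rightarrow>
    ('n, 'd) tall \<Rightarrow> ('n, 'd) tall \<Rightarrow> 'b" where
  "tdO F \<equiv> tangent_deriv orth_prod F"

lemma smooth_quot_fun_iff: "smooth_quot_fun \<phi> \<longleftrightarrow> smO (\<lambda>x. \<phi> (quot x))"
  by (simp add: smooth_quot_fun_def smooth_fun_on_eq o_def)

text \<open>An explicit form of the differential of the projection, used in place of the description
  in \<open>quot_diff\<close>. The default 0 matches that of \<open>velocity\<close>, so that the
  two agree as functions.\<close>

definition tvec :: "('n::finite, 'd::finite) tall \<Rightarrow> ('n, 'd) tall \<Rightarrow> ('n, 'd) qtangent" where
  "tvec G v = (\<lambda>\<phi>. if smooth_quot_fun \<phi> then tdO (\<lambda>x. \<phi> (quot x)) G v else 0)"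

lemma velocity_curve:
  fixes G :: "('n::finite, 'd::finite) tall"
  assumes "smooth_curve_in orth_prod c" "c 0 = G" "(c has_vector_derivative v) (at 0)"
  shows "velocity (quot \<circ> c) = tvec G v"
proof
  fix \<phi> :: "('n, 'd) tall set \<Rightarrow> real"
  show "velocity (quot \<circ> c) \<phi> = tvec G v \<phi>"
  proof (cases "smooth_quot_fun \<phi>")
    case True
    then have "((\<lambda>t. \<phi> (quot (c t))) has_vector_derivative tdO (\<lambda>x. \<phi> (quot x)) G v) (at 0)"
      unfolding smooth_quot_fun_iff by (rule tangent_deriv_curve[OF _ assms])
    then have "deriv (\<lambda>t. \<phi> (quot (c t))) 0 = tdO (\<lambda>x. \<phi> (quot x)) G v"
      by (intro DERIV_imp_deriv) (simp add: has_real_derivative_iff_has_vector_derivative)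
    then show ?thesis using True by (simp add: velocity_def tvec_def o_def)
  qed (simp add: velocity_def tvec_def)
qed

lemma quot_diff_eq:
  assumes "v \<in> tanO G"
  shows "quot_diff G v = tvec G v"
  unfolding quot_diff_def
proof (rule the_equality)
  show "\<forall>c. smooth_curve_in orth_prod c \<and> c 0 = G \<and> vector_derivative c (at 0) = v \<longrightarrow>
      tvec G v = velocity (quot \<circ> c)"
    using velocity_curve smooth_on_vector_derivative unfolding smooth_curve_in_def by metis
next
  fix \<xi> assume *: "\<forall>c. smooth_curve_in orth_prod c \<and> c 0 = G \<and> vector_derivative c (at 0) = v \<longrightarrow>
      \<xi> = velocity (quot \<circ> c)"
  obtain c where c: "smooth_curve_in orth_prod c" "c 0 = G" "(c has_vector_derivative v) (at 0)"
    using assms by (rule tangent_spaceE)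
  then show "\<xi> = tvec G v" using * velocity_curve[OF c] vector_derivative_at[OF c(3)] by metis
qed

lemma tvec_smooth: "smooth_quot_fun \<phi> \<Longrightarrow> tvec G v \<phi> = tdO (\<lambda>x. \<phi> (quot x)) G v"
  by (simp add: tvec_def)

lemma tvec_not_smooth: "\<not> smooth_quot_fun \<phi> \<Longrightarrow> tvec G v \<phi> = 0"
  by (simp add: tvec_def)

lemma linear_tvec:
  assumes "G \<in> orth_prod"
  shows "linear (\<lambda>v. tvec G v \<phi>)"
proof (cases "smooth_quot_fun \<phi>")
  case True
  then show ?thesis
    using linear_tangent_deriv[OF _ assms, of "\<lambda>x. \<phi> (quot x)"] by (simp add: tvec_smooth smooth_quot_fun_iff)
qed (simp add: tvec_def linear_zero)

text \<open>A function of the orbit is constant along the fibre curve \<open>G ** R t\<close>, whose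
  velocity is \<open>G ** K\<close>.\<close>

lemma tvec_vertical:
  assumes "G \<in> orth_prod" "transpose K = - K"
  shows "tvec G (G ** K) \<phi> = 0"
proof (cases "smooth_quot_fun \<phi>")
  case True
  obtain R where R: "orth_curve K R" using skew_has_orth_curve[OF assms(2)] by blast
  have "((\<lambda>t. \<phi> (quot (G ** R t))) has_vector_derivative tdO (\<lambda>x. \<phi> (quot x)) G (G ** K)) (at 0)"
    using True vertical_curve[OF assms(1) R] unfolding smooth_quot_fun_iff
    by (intro tangent_deriv_curve) (auto intro: smooth_curve_in_subset)
  then have "((\<lambda>t. \<phi> (quot G)) has_vector_derivative tdO (\<lambda>x. \<phi> (quot x)) G (G ** K)) (at 0)"
    using R by (simp add: orth_curve_def quot_mult)
  then show ?thesis
    using vector_derivative_unique_at[OF _ has_vector_derivative_const] True by (simp add: tvec_smooth)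
qed (simp add: tvec_def)

lemma tvec_hproj:
  assumes "w \<in> tanO G"
  shows "tvec G (hproj G w) = tvec G w"
proof
  fix \<phi>
  obtain K where K: "transpose K = - K" "w = hproj G w + G ** K"
    using hproj_tangent_diff[OF assms] by blast
  have G: "G \<in> orth_prod" by (rule tangent_space_base[OF assms])
  show "tvec G (hproj G w) \<phi> = tvec G w \<phi>"
    using linear_add[OF linear_tvec[OF G], of "hproj G w" "G ** K" \<phi>] tvec_vertical[OF G K(1)] K(2) by simp
qed

text \<open>A curve and its right translate by Q project to the same curve of orbits.\<close>

lemma tvec_mult:
  assumes v: "v \<in> tanO G" and Q: "orthogonal_matrix Q"
  shows "tvec (G ** Q) (v ** Q) = tvec G v"
proof -
  obtain c where c: "smooth_curve_in orth_prod c" "c 0 = G" "(c has_vector_derivative v) (at 0)"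
    using v by (rule tangent_spaceE)
  have "((\<lambda>t. c t ** Q) has_vector_derivative v ** Q) (at 0)"
    by (rule bounded_linear.has_vector_derivative[OF bounded_bilinear.bounded_linear_left[OF bounded_bilinear_matrix_mult] c(3)])
  moreover have "smooth_curve_in orth_prod (\<lambda>t. c t ** Q)"
    using c(1) Q by (auto simp: smooth_curve_in_def orth_prod_mult smooth_on_matrix_mult smooth_on_const)
  ultimately have "velocity (quot \<circ> (\<lambda>t. c t ** Q)) = tvec (G ** Q) (v ** Q)"
    by (intro velocity_curve) (simp_all add: c(2))
  moreover have "quot \<circ> (\<lambda>t. c t ** Q) = quot \<circ> c" by (simp add: fun_eq_iff quot_mult[OF Q])
  ultimately show ?thesis using velocity_curve[OF c] by simp
qed


subsection \<open>A global section\<close>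

(* Q is a product of n - 1 copies of O(d): normalise one block to the identity. *)
definition rep :: "('n::finite, 'd::finite) tall set \<Rightarrow> ('n, 'd) tall" where
  "rep p = (let x = (SOME x. x \<in> orth_prod \<and> quot x = p) in x ** transpose (blk x undefined))"

text \<open>Another representative \<open>x ** Q\<close> contributes Q from the first factor and its
  transpose from the second, and these cancel. So the choice inside \<open>rep\<close> has no
  effect, and the section is quadratic in the entries of x.\<close>

lemma rep_quot:
  assumes x: "x \<in> orth_prod"
  shows "rep (quot x) = x ** transpose (blk x undefined)"
proof -
  define y where "y = (SOME y. y \<in> orth_prod \<and> quot y = quot x)"
  have y: "y \<in> orth_prod" "quot y = quot x"
    using someI[of "\<lambda>y. y \<in> orth_prod \<and> quot y = quot x", OF conjI[OF x refl]] by (auto simp: y_def)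
  then obtain Q where Q: "orthogonal_matrix Q" "y = x ** Q" by (metis quot_eq_iff)
  have "rep (quot x) = x ** (Q ** transpose Q) ** transpose (blk x undefined)"
    by (simp add: rep_def Let_def y_def[symmetric] Q(2) blk_mult transpose_simps matrix_mul_assoc)
  then show ?thesis using Q(1) by (simp add: orthogonal_matrix_def)
qed

lemma rep_quot_mult:
  assumes x: "x \<in> orth_prod"
  shows "\<exists>Q. orthogonal_matrix Q \<and> rep (quot x) = x ** Q"
  using x unfolding rep_quot[OF x] orth_prod_def by (metis (mono_tags) mem_Collect_eq orthogonal_matrix_transpose)

lemma rep_quot_in: "x \<in> orth_prod \<Longrightarrow> rep (quot x) \<in> orth_prod"
  using rep_quot_mult orth_prod_mult by metis

lemma quot_rep_quot: "x \<in> orth_prod \<Longrightarrow> quot (rep (quot x)) = quot x"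
  using rep_quot_mult quot_mult by metis

lemma quot_in: "x \<in> orth_prod \<Longrightarrow> quot x \<in> quot_mfd"
  by (simp add: quot_mfd_def)

lemma rep_in: "p \<in> quot_mfd \<Longrightarrow> rep p \<in> orth_prod" and quot_rep: "p \<in> quot_mfd \<Longrightarrow> quot (rep p) = p"
  by (auto simp: quot_mfd_def rep_quot_in quot_rep_quot)

lemma smO_mult:
  fixes F :: "('n::finite, 'd::finite) tall \<Rightarrow> real^'k^'m" and G :: "('n, 'd) tall \<Rightarrow> real^'p^'k"
  shows "smO F \<Longrightarrow> smO G \<Longrightarrow> smO (\<lambda>x. F x ** G x)"
  by (rule smooth_map_on_bilinear[OF bounded_bilinear_matrix_mult])

lemma smO_transpose:
  fixes F :: "('n::finite, 'd::finite) tall \<Rightarrow> real^'k^'m"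
  shows "smO F \<Longrightarrow> smO (\<lambda>x. transpose (F x))"
  by (rule smooth_map_on_bounded_linear[OF bounded_linear_transpose])

lemma smO_nth: "smO F \<Longrightarrow> smO (\<lambda>x. F x $ i)"
  by (rule smooth_map_on_bounded_linear[OF bounded_linear_vec_nth])

lemma smO_rep: "smO (\<lambda>x::('n::finite, 'd::finite) tall. rep (quot x))"
proof -
  have "smO (\<lambda>x::('n, 'd) tall. x ** transpose (blk x undefined))"
    by (intro smO_mult smO_transpose smooth_map_on_ident smooth_map_on_bounded_linear[OF bounded_linear_blk])
  then show ?thesis by (rule smooth_map_on_cong[THEN iffD1, rotated]) (simp add: rep_quot)
qed


subsection \<open>The tangent spaces of the quotient\<close>

(* The entries of the invariant embedding [G] \<mapsto> G G\<^sup>T; differentiating it along a horizontal v and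
   multiplying by G gives n v, which recovers the horizontal lift from a tangent vector. *)
definition gram :: "('n::finite \<times> 'd::finite) \<Rightarrow> ('n \<times> 'd) \<Rightarrow> ('n, 'd) tall set \<Rightarrow> real" where
  "gram r s p = (rep p ** transpose (rep p)) $ r $ s"

lemma gram_quot:
  assumes x: "x \<in> orth_prod"
  shows "gram r s (quot x) = (x ** transpose x) $ r $ s"
proof -
  obtain Q where Q: "orthogonal_matrix Q" "rep (quot x) = x ** Q" using rep_quot_mult[OF x] by blast
  have "rep (quot x) ** transpose (rep (quot x)) = x ** (Q ** transpose Q) ** transpose x"
    by (simp add: Q(2) transpose_simps matrix_mul_assoc)
  then show ?thesis using Q(1) by (simp add: gram_def orthogonal_matrix_def)
qed

lemma smO_gram: "smO (\<lambda>x. (x ** transpose x) $ r $ s)"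
  by (intro smO_nth smO_mult smO_transpose smooth_map_on_ident)

lemma smooth_gram: "smooth_quot_fun (gram r s)"
  unfolding smooth_quot_fun_iff
  by (rule smooth_map_on_cong[THEN iffD1, OF _ smO_gram]) (simp add: gram_quot)

definition gram_mat :: "('n::finite, 'd::finite) qtangent \<Rightarrow> ('n, 'd) big" where
  "gram_mat \<xi> = (\<chi> r s. \<xi> (gram r s))"

lemma gram_mat_tvec:
  fixes G :: "('n::finite, 'd::finite) tall"
  assumes v: "v \<in> tanO G"
  shows "gram_mat (tvec G v) = G ** transpose v + v ** transpose G"
proof -
  have sm: "smO (\<lambda>x::('n, 'd) tall. transpose x)" "smO (\<lambda>x::('n, 'd) tall. x ** transpose x)"
      "smO (\<lambda>x::('n, 'd) tall. (x ** transpose x) $ r)" for r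
    by (intro smO_nth smO_mult smO_transpose smooth_map_on_ident)+
  have "tvec G v (gram r s) = (G ** transpose v + v ** transpose G) $ r $ s" for r s
  proof -
    have "tvec G v (gram r s) = tdO (\<lambda>x. (x ** transpose x) $ r $ s) G v"
      unfolding tvec_smooth[OF smooth_gram] by (simp add: gram_quot cong: tangent_deriv_cong)
    also have "\<dots> = tdO (\<lambda>x. (x ** transpose x) $ r) G v $ s"
      by (rule tangent_deriv_bounded_linear[OF v sm(3) bounded_linear_vec_nth])
    also have "tdO (\<lambda>x. (x ** transpose x) $ r) G v = tdO (\<lambda>x. x ** transpose x) G v $ r"
      by (rule tangent_deriv_bounded_linear[OF v sm(2) bounded_linear_vec_nth])
    also have "tdO (\<lambda>x. x ** transpose x) G v = G ** transpose v + v ** transpose G"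
      by (simp add: tangent_deriv_bilinear[OF v smooth_map_on_ident sm(1) bounded_bilinear_matrix_mult]
          tangent_deriv_bounded_linear[OF v smooth_map_on_ident bounded_linear_transpose] tangent_deriv_ident[OF v])
    finally show ?thesis .
  qed
  then show ?thesis by (simp add: gram_mat_def vec_eq_iff)
qed

lemma gram_mat_horizontal:
  fixes G :: "('n::finite, 'd::finite) tall"
  assumes G: "G \<in> orth_prod" and v: "v \<in> horizontal_space G"
  shows "(1 / real CARD('n)) *\<^sub>R (gram_mat (tvec G v) ** G) = v"
proof -
  have v0: "transpose G ** v = 0" "v \<in> tanO G" using v by (auto simp: horizontal_space_eq[OF G])
  then have "transpose v ** G = 0" by (metis transpose_simps(5,6,7))
  then have "gram_mat (tvec G v) ** G = real CARD('n) *\<^sub>R v"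
    by (simp add: gram_mat_tvec[OF v0(2)] matrix_mult_simps matrix_mul_assoc[symmetric] orth_prod_gram[OF G])
  then show ?thesis by simp
qed

text \<open>Composing the curve with the global section gives a lift, and a constant orthogonal
  factor moves its starting point to G.\<close>

lemma smooth_curve_lift:
  fixes G :: "('n::finite, 'd::finite) tall"
  assumes \<gamma>: "smooth_quot_curve \<gamma>" "\<gamma> 0 = quot G" and G: "G \<in> orth_prod"
  obtains c where "smooth_curve_in orth_prod c" "c 0 = G" "quot \<circ> c = \<gamma>"
proof -
  obtain Q where Q: "orthogonal_matrix Q" "G = rep (quot G) ** Q"
    using quot_rep_quot[OF G] by (metis quot_eq_iff)
  have mfd: "\<gamma> t \<in> quot_mfd" for t using \<gamma>(1) by (simp add: smooth_quot_curve_def)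
  \<comment> \<open>Smoothness of \<open>\<gamma>\<close> is tested by real-valued functions only,
    so the section is fed in entry by entry.\<close>
  have "smooth_quot_fun (\<lambda>p. rep p $ r $ b)" for r :: "'n \<times> 'd" and b
    unfolding smooth_quot_fun_iff by (intro smO_nth smO_rep)
  then have "smooth_on (\<lambda>t. rep (\<gamma> t) $ r $ b) UNIV" for r b
    using \<gamma>(1) unfolding smooth_quot_curve_def o_def by blast
  then have sm: "smooth_on (\<lambda>t. rep (\<gamma> t)) UNIV"
    by (intro smooth_on_vec open_UNIV)
  show ?thesis
  proof
    show "smooth_curve_in orth_prod (\<lambda>t. rep (\<gamma> t) ** Q)"
      using sm Q mfd by (auto simp: smooth_curve_in_def orth_prod_mult rep_in smooth_on_matrix_mult smooth_on_const)
    show "rep (\<gamma> 0) ** Q = G" using Q(2) \<gamma>(2) by simp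
    show "quot \<circ> (\<lambda>t. rep (\<gamma> t) ** Q) = \<gamma>" using Q mfd by (auto simp: quot_mult quot_rep)
  qed
qed

lemma smooth_quot_curve_quot:
  assumes "smooth_curve_in orth_prod c"
  shows "smooth_quot_curve (quot \<circ> c)"
  using assms smooth_map_on_curve[OF _ assms]
  by (auto simp: smooth_quot_curve_def smooth_quot_fun_iff o_def smooth_curve_in_def quot_in)

lemma quot_tangent_space_eq:
  assumes G: "G \<in> orth_prod"
  shows "quot_tangent_space (quot G) = tvec G ` horizontal_space G"
proof (intro equalityI subsetI)
  fix \<xi> assume "\<xi> \<in> quot_tangent_space (quot G)"
  then obtain \<gamma> where \<gamma>: "\<xi> = velocity \<gamma>" "smooth_quot_curve \<gamma>" "\<gamma> 0 = quot G"
    by (auto simp: quot_tangent_space_def)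
  obtain c where c: "smooth_curve_in orth_prod c" "c 0 = G" "quot \<circ> c = \<gamma>"
    by (rule smooth_curve_lift[OF \<gamma>(2,3) G])
  have d: "(c has_vector_derivative vector_derivative c (at 0)) (at 0)"
    using c(1) by (auto simp: smooth_curve_in_def intro: smooth_on_vector_derivative)
  have "\<xi> = tvec G (hproj G (vector_derivative c (at 0)))"
    using velocity_curve[OF c(1,2) d] tvec_hproj[OF tangent_spaceI[OF c(1,2) d]] by (simp add: c(3) \<gamma>(1))
  then show "\<xi> \<in> tvec G ` horizontal_space G" using hproj_horizontal[OF G] by blast
next
  fix \<xi> assume "\<xi> \<in> tvec G ` horizontal_space G"
  then obtain v where v: "v \<in> horizontal_space G" "\<xi> = tvec G v" by blast
  obtain c where c: "smooth_curve_in orth_prod c" "c 0 = G" "(c has_vector_derivative v) (at 0)"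
    by (rule tangent_spaceE[OF horizontal_tangent[OF v(1)]])
  show "\<xi> \<in> quot_tangent_space (quot G)"
    unfolding quot_tangent_space_def v(2) velocity_curve[OF c, symmetric]
    using smooth_quot_curve_quot[OF c(1)] c(2) by force
qed

lemma tvec_in: "w \<in> tanO G \<Longrightarrow> tvec G w \<in> quot_tangent_space (quot G)"
  by (metis hproj_horizontal imageI quot_tangent_space_eq tangent_space_base tvec_hproj)

lemma tvec_inj: "G \<in> orth_prod \<Longrightarrow> v \<in> horizontal_space G \<Longrightarrow> w \<in> horizontal_space G \<Longrightarrow> tvec G v = tvec G w \<Longrightarrow> v = w"
  by (metis gram_mat_horizontal)

lemma is_horizontal_lift_iff:
  "is_horizontal_lift G \<xi> v \<longleftrightarrow> v \<in> horizontal_space G \<and> tvec G v = \<xi>"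
  unfolding is_horizontal_lift_def using quot_diff_eq horizontal_tangent by metis

lemma horizontal_lift_tvec:
  assumes "G \<in> orth_prod" "v \<in> horizontal_space G"
  shows "horizontal_lift G (tvec G v) = v"
  unfolding horizontal_lift_def is_horizontal_lift_iff
  by (rule the_equality) (use assms tvec_inj in auto)

lemma
  assumes "G \<in> orth_prod" "\<xi> \<in> quot_tangent_space (quot G)"
  shows horizontal_lift_in: "horizontal_lift G \<xi> \<in> horizontal_space G"
    and tvec_horizontal_lift: "tvec G (horizontal_lift G \<xi>) = \<xi>"
  using assms by (auto simp: quot_tangent_space_eq horizontal_lift_tvec)

lemma horizontal_lift_gram:
  fixes G :: "('n::finite, 'd::finite) tall"
  assumes "G \<in> orth_prod" "\<xi> \<in> quot_tangent_space (quot G)"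
  shows "horizontal_lift G \<xi> = (1 / real CARD('n)) *\<^sub>R (gram_mat \<xi> ** G)"
  using gram_mat_horizontal[OF assms(1) horizontal_lift_in[OF assms]] tvec_horizontal_lift[OF assms] by simp

lemma horizontal_lift_mult:
  assumes "G \<in> orth_prod" "\<xi> \<in> quot_tangent_space (quot G)" "orthogonal_matrix Q"
  shows "horizontal_lift (G ** Q) \<xi> = horizontal_lift G \<xi> ** Q"
  using assms by (simp add: horizontal_lift_gram orth_prod_mult quot_mult matrix_mult_simps matrix_mul_assoc)

text \<open>Passing to the representative \<open>G ** Q\<close> multiplies both lifts by Q on the
  right, which is an isometry. Uniqueness of the described number holds because G itself lies in its
  orbit.\<close>

lemma quot_metric_eq:
  assumes G: "G \<in> orth_prod" and "\<xi> \<in> quot_tangent_space (quot G)" "\<eta> \<in> quot_tangent_space (quot G)"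
  shows "quot_metric (quot G) \<xi> \<eta> = horizontal_lift G \<xi> \<bullet> horizontal_lift G \<eta>"
  unfolding quot_metric_def
proof (rule the_equality)
  show "\<forall>G'\<in>quot G. horizontal_lift G \<xi> \<bullet> horizontal_lift G \<eta> = frob (horizontal_lift G' \<xi>) (horizontal_lift G' \<eta>)"
  proof
    fix G' assume "G' \<in> quot G"
    then obtain Q where Q: "orthogonal_matrix Q" "G' = G ** Q" by (auto simp: mem_quot)
    show "horizontal_lift G \<xi> \<bullet> horizontal_lift G \<eta> = frob (horizontal_lift G' \<xi>) (horizontal_lift G' \<eta>)"
      using Q(1) by (simp add: Q(2) frob_inner horizontal_lift_mult[OF G assms(2) Q(1)]
        horizontal_lift_mult[OF G assms(3) Q(1)] inner_mult_right orthogonal_matrix_def flip: matrix_mul_assoc)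
  qed
qed (use self_mem_quot in \<open>auto simp: frob_inner\<close>)


section \<open>Vector fields on the quotient and their lifts\<close>

definition lft :: "('n::finite, 'd::finite) qfield \<Rightarrow> ('n, 'd) tall \<Rightarrow> ('n, 'd) tall" where
  "lft X x = horizontal_lift x (X (quot x))"

lemma vector_fieldsD:
  assumes "X \<in> vector_fields"
  shows "p \<in> quot_mfd \<Longrightarrow> X p \<in> quot_tangent_space p"
    and "p \<notin> quot_mfd \<Longrightarrow> X p = (\<lambda>\<phi>. 0)"
    and "smooth_quot_fun \<phi> \<Longrightarrow> smooth_quot_fun (\<lambda>p. X p \<phi>)"
  using assms by (auto simp: vector_fields_def)

lemma
  assumes X: "X \<in> vector_fields" and x: "x \<in> orth_prod"
  shows lft_horizontal: "lft X x \<in> horizontal_space x"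
    and tvec_lft: "tvec x (lft X x) = X (quot x)"
    and lft_tangent: "lft X x \<in> tanO x"
proof -
  have "X (quot x) \<in> quot_tangent_space (quot x)" by (rule vector_fieldsD(1)[OF X quot_in[OF x]])
  then show *: "lft X x \<in> horizontal_space x" "tvec x (lft X x) = X (quot x)"
    unfolding lft_def by (simp_all add: x horizontal_lift_in tvec_horizontal_lift)
  show "lft X x \<in> tanO x" by (rule horizontal_tangent[OF *(1)])
qed

lemma smO_lft:
  fixes X :: "('n::finite, 'd::finite) qfield"
  assumes X: "X \<in> vector_fields"
  shows "smO (lft X)"
proof -
  have "smO (\<lambda>x. X (quot x) (gram r s))" for r s
    using vector_fieldsD(3)[OF X smooth_gram] by (simp add: smooth_quot_fun_iff)
  then have "smO (\<lambda>x. gram_mat (X (quot x)))"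
    by (intro smooth_map_on_vec) (simp add: gram_mat_def)
  then have "smO (\<lambda>x. (1 / real CARD('n)) *\<^sub>R (gram_mat (X (quot x)) ** x))"
    by (intro smooth_map_on_bounded_linear[OF bounded_linear_scaleR_right] smO_mult smooth_map_on_ident)
  then show ?thesis
    by (rule smooth_map_on_cong[THEN iffD1, rotated])
      (simp add: lft_def horizontal_lift_gram vector_fieldsD(1)[OF X] quot_in)
qed

lemma field_apply:
  assumes "X \<in> vector_fields" "x \<in> orth_prod" "smooth_quot_fun \<phi>"
  shows "X (quot x) \<phi> = tdO (\<lambda>y. \<phi> (quot y)) x (lft X x)"
  using tvec_lft[OF assms(1,2)] assms(3) by (metis tvec_smooth)

lemma lft_eqI:
  assumes "x \<in> orth_prod" "v \<in> horizontal_space x" "X (quot x) = tvec x v"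
  shows "lft X x = v"
  using assms by (simp add: lft_def horizontal_lift_tvec)

text \<open>The lift at a single representative already determines the tangent vector at p, so the
  lifts need not be compared on the whole fibre.\<close>

lemma field_eqI:
  assumes "X \<in> vector_fields" "Y \<in> vector_fields"
    and "\<And>p. p \<in> quot_mfd \<Longrightarrow> lft X (rep p) = lft Y (rep p)"
  shows "X = Y"
proof
  fix p
  show "X p = Y p"
  proof (cases "p \<in> quot_mfd")
    case True
    then show ?thesis
      using tvec_lft[OF assms(1) rep_in[OF True]] tvec_lft[OF assms(2) rep_in[OF True]] assms(3)[OF True]
      by (simp add: quot_rep)
  qed (simp add: vector_fieldsD(2)[OF assms(1)] vector_fieldsD(2)[OF assms(2)])
qed

text \<open>Only the values of V on the image of the section enter, so V need not be equivariant. In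
  return, the lift of the resulting field is known to equal V at the chosen representatives
  only.\<close>

definition mkfield :: "(('n::finite, 'd::finite) tall \<Rightarrow> ('n, 'd) tall) \<Rightarrow> ('n, 'd) qfield" where
  "mkfield V p = (if p \<in> quot_mfd then tvec (rep p) (V (rep p)) else (\<lambda>\<phi>. 0))"

lemma mkfield_in:
  assumes V: "smO V" "\<And>x. x \<in> orth_prod \<Longrightarrow> V x \<in> tanO x"
  shows "mkfield V \<in> vector_fields"
proof -
  have "mkfield V p \<in> quot_tangent_space p" if "p \<in> quot_mfd" for p
    using tvec_in[OF V(2)[OF rep_in[OF that]]] that by (simp add: mkfield_def quot_rep)
  moreover have "smooth_quot_fun (\<lambda>p. mkfield V p \<phi>)" if \<phi>: "smooth_quot_fun \<phi>" for \<phi>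
  proof -
    have "smO (\<lambda>x. tdO (\<lambda>y. \<phi> (quot y)) x (V x))"
      using \<phi> by (intro smooth_map_on_tangent_deriv V) (simp_all add: smooth_quot_fun_iff)
    \<comment> \<open>Precomposition with the section keeps smoothness and makes the function
      constant on orbits.\<close>
    then have "smO (\<lambda>x. tdO (\<lambda>y. \<phi> (quot y)) (rep (quot x)) (V (rep (quot x))))"
      by (rule smooth_map_on_compose[OF smO_rep]) (auto simp: rep_quot_in)
    then show ?thesis
      unfolding smooth_quot_fun_iff
      by (rule smooth_map_on_cong[THEN iffD1, rotated]) (simp add: mkfield_def quot_in tvec_smooth[OF \<phi>])
  qed
  ultimately show ?thesis by (simp add: vector_fields_def mkfield_def)
qed

lemma lft_mkfield:
  assumes "p \<in> quot_mfd" "V (rep p) \<in> horizontal_space (rep p)"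
  shows "lft (mkfield V) (rep p) = V (rep p)"
  by (rule lft_eqI) (use assms in \<open>simp_all add: rep_in quot_rep mkfield_def\<close>)

lemma smO_hproj:
  fixes V :: "('n::finite, 'd::finite) tall \<Rightarrow> ('n, 'd) tall"
  assumes "smO V"
  shows "smO (\<lambda>x. hproj x (V x))"
  unfolding hproj_def tproj_def
  by (intro smooth_map_on_diff smO_mult smO_transpose smooth_map_on_ident assms
      smooth_map_on_bounded_linear[OF bounded_linear_scaleR_right]
      smooth_map_on_bounded_linear[OF bounded_linear_of_linear[OF linear_symblockdiag]])

text \<open>The fixed matrix v is projected to the horizontal space at every point; at
  \<open>rep p\<close> it is already horizontal and stays unchanged. This yields a global field
  without cut-off functions.\<close>

lemma field_extends:
  assumes p: "p \<in> quot_mfd" and v: "v \<in> horizontal_space (rep p)"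
  obtains X where "X \<in> vector_fields" "lft X (rep p) = v"
proof
  show "mkfield (\<lambda>x. hproj x v) \<in> vector_fields"
    by (intro mkfield_in smO_hproj smooth_map_on_const horizontal_tangent hproj_horizontal)
  show "lft (mkfield (\<lambda>x. hproj x v)) (rep p) = v"
    using lft_mkfield[OF p, of "\<lambda>x. hproj x v"] by (simp add: hproj_id hproj_horizontal rep_in[OF p] v)
qed

lemma field_add_quot:
  assumes "X \<in> vector_fields" "Y \<in> vector_fields" "x \<in> orth_prod"
  shows "field_add X Y (quot x) = tvec x (lft X x + lft Y x)"
  unfolding field_add_def
  by (rule ext) (simp add: linear_add[OF linear_tvec[OF assms(3)]] tvec_lft assms)

lemma field_scale_quot:
  assumes "X \<in> vector_fields" "x \<in> orth_prod"
  shows "field_scale h X (quot x) = tvec x (h (quot x) *\<^sub>R lft X x)"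
  unfolding field_scale_def
  by (rule ext) (simp add: linear_scale[OF linear_tvec[OF assms(2)]] tvec_lft assms)

lemma lft_field_add:
  assumes "X \<in> vector_fields" "Y \<in> vector_fields" "x \<in> orth_prod"
  shows "lft (field_add X Y) x = lft X x + lft Y x"
  using assms by (intro lft_eqI field_add_quot) (auto intro: subspace_add[OF subspace_horizontal] lft_horizontal)

lemma lft_field_scale:
  assumes "X \<in> vector_fields" "x \<in> orth_prod"
  shows "lft (field_scale h X) x = h (quot x) *\<^sub>R lft X x"
  using assms by (intro lft_eqI field_scale_quot) (auto intro: subspace_scale[OF subspace_horizontal] lft_horizontal)

lemma field_add_in:
  assumes X: "X \<in> vector_fields" and Y: "Y \<in> vector_fields"
  shows "field_add X Y \<in> vector_fields"
proof -
  have "field_add X Y p \<in> quot_tangent_space p" if "p \<in> quot_mfd" for p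
  proof -
    note x = rep_in[OF that]
    have "tvec (rep p) (lft X (rep p) + lft Y (rep p)) \<in> quot_tangent_space (quot (rep p))"
      by (intro tvec_in subspace_add[OF subspace_tangent] lft_tangent X Y x)
    then show ?thesis using field_add_quot[OF X Y x] by (simp add: quot_rep[OF that])
  qed
  moreover have "smooth_quot_fun (\<lambda>p. field_add X Y p \<phi>)" if "smooth_quot_fun \<phi>" for \<phi>
    using vector_fieldsD(3)[OF X that] vector_fieldsD(3)[OF Y that]
    by (simp add: smooth_quot_fun_iff field_add_def smooth_map_on_add)
  ultimately show ?thesis
    using vector_fieldsD(2)[OF X] vector_fieldsD(2)[OF Y] by (simp add: vector_fields_def field_add_def)
qed

lemma smO_times: "smO F \<Longrightarrow> smO G \<Longrightarrow> smO (\<lambda>x. F x * G x :: real)"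
  by (rule smooth_map_on_bilinear[OF bounded_bilinear_mult])

lemma field_scale_in:
  assumes X: "X \<in> vector_fields" and h: "smooth_quot_fun h"
  shows "field_scale h X \<in> vector_fields"
proof -
  have "field_scale h X p \<in> quot_tangent_space p" if "p \<in> quot_mfd" for p
  proof -
    note x = rep_in[OF that]
    have "tvec (rep p) (h (quot (rep p)) *\<^sub>R lft X (rep p)) \<in> quot_tangent_space (quot (rep p))"
      by (intro tvec_in subspace_scale[OF subspace_tangent] lft_tangent X x)
    then show ?thesis using field_scale_quot[OF X x] by (simp add: quot_rep[OF that])
  qed
  moreover have "smooth_quot_fun (\<lambda>p. field_scale h X p \<phi>)" if "smooth_quot_fun \<phi>" for \<phi>
    using vector_fieldsD(3)[OF X that] h
    by (simp add: smooth_quot_fun_iff field_scale_def smO_times)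
  ultimately show ?thesis
    using vector_fieldsD(2)[OF X] by (simp add: vector_fields_def field_scale_def)
qed


section \<open>The Levi-Civita connection\<close>

text \<open>The zero branch is what the last clause of \<open>levi_civita\<close> prescribes for
  arguments that are not smooth fields.\<close>

definition conn :: "('n::finite, 'd::finite) qfield \<Rightarrow> ('n, 'd) qfield \<Rightarrow> ('n, 'd) qfield" where
  "conn X Y = (if X \<in> vector_fields \<and> Y \<in> vector_fields
     then mkfield (\<lambda>x. hproj x (tdO (lft Y) x (lft X x))) else (\<lambda>p \<phi>. 0))"

lemma conn_in:
  assumes "X \<in> vector_fields" "Y \<in> vector_fields"
  shows "conn X Y \<in> vector_fields"
proof -
  have "mkfield (\<lambda>x. hproj x (tdO (lft Y) x (lft X x))) \<in> vector_fields"
    by (intro mkfield_in smO_hproj smooth_map_on_tangent_deriv smO_lft lft_tangent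
        horizontal_tangent hproj_horizontal assms)
  then show ?thesis by (simp add: conn_def assms)
qed

lemma lft_conn:
  assumes "X \<in> vector_fields" "Y \<in> vector_fields" "p \<in> quot_mfd"
  shows "lft (conn X Y) (rep p) = hproj (rep p) (tdO (lft Y) (rep p) (lft X (rep p)))"
  unfolding conn_def using assms by (simp add: lft_mkfield hproj_horizontal rep_in)

lemma td_lft_add:
  assumes "X \<in> vector_fields" "Y \<in> vector_fields" "v \<in> tanO x"
  shows "tdO (lft (field_add X Y)) x v = tdO (lft X) x v + tdO (lft Y) x v"
proof -
  have "tdO (lft (field_add X Y)) x v = tdO (\<lambda>y. lft X y + lft Y y) x v"
    by (simp add: lft_field_add assms cong: tangent_deriv_cong)
  then show ?thesis by (simp add: tangent_deriv_add smO_lft assms)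
qed

lemma td_lft_scale:
  assumes "X \<in> vector_fields" "smooth_quot_fun h" "v \<in> tanO x"
  shows "tdO (lft (field_scale h X)) x v = h (quot x) *\<^sub>R tdO (lft X) x v + tdO (\<lambda>y. h (quot y)) x v *\<^sub>R lft X x"
proof -
  have "tdO (lft (field_scale h X)) x v = tdO (\<lambda>y. h (quot y) *\<^sub>R lft X y) x v"
    by (simp add: lft_field_scale assms cong: tangent_deriv_cong)
  then show ?thesis
    using tangent_deriv_bilinear[OF assms(3) _ smO_lft[OF assms(1)] bounded_bilinear_scaleR, of "\<lambda>y. h (quot y)"] assms(2)
    by (simp add: smooth_quot_fun_iff)
qed

lemma linear_td_lft: "X \<in> vector_fields \<Longrightarrow> x \<in> orth_prod \<Longrightarrow> linear (tdO (lft X) x)"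
  by (intro linear_tangent_deriv smO_lft)

lemma affine_connection_conn: "affine_connection conn"
  unfolding affine_connection_def
proof (intro conjI ballI allI impI)
  fix X Y :: "('n::finite, 'd::finite) qfield"
  assume X: "X \<in> vector_fields" and Y: "Y \<in> vector_fields"
  show "conn X Y \<in> vector_fields" by (rule conn_in[OF X Y])
  {
    fix X' :: "('n, 'd) qfield" assume X': "X' \<in> vector_fields"
    show "conn (field_add X X') Y = field_add (conn X Y) (conn X' Y)"
    proof (rule field_eqI)
      fix p :: "('n, 'd) tall set" assume p: "p \<in> quot_mfd"
      note x = rep_in[OF p]
      show "lft (conn (field_add X X') Y) (rep p) = lft (field_add (conn X Y) (conn X' Y)) (rep p)"
        by (simp add: lft_conn lft_field_add conn_in field_add_in p x X X' Y
            linear_add[OF linear_td_lft[OF Y x]] linear_add[OF linear_hproj])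
    qed (intro conn_in field_add_in X X' Y)+
  next
    fix Y' :: "('n, 'd) qfield" assume Y': "Y' \<in> vector_fields"
    show "conn X (field_add Y Y') = field_add (conn X Y) (conn X Y')"
    proof (rule field_eqI)
      fix p :: "('n, 'd) tall set" assume p: "p \<in> quot_mfd"
      note x = rep_in[OF p]
      show "lft (conn X (field_add Y Y')) (rep p) = lft (field_add (conn X Y) (conn X Y')) (rep p)"
        by (simp add: lft_conn lft_field_add conn_in field_add_in p x X Y Y' td_lft_add lft_tangent
            linear_add[OF linear_hproj])
    qed (intro conn_in field_add_in X Y Y')+
  next
    fix h :: "('n, 'd) tall set \<Rightarrow> real" assume h: "smooth_quot_fun h"
    show "conn (field_scale h X) Y = field_scale h (conn X Y)"
    proof (rule field_eqI)
      fix p :: "('n, 'd) tall set" assume p: "p \<in> quot_mfd"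
      note x = rep_in[OF p]
      show "lft (conn (field_scale h X) Y) (rep p) = lft (field_scale h (conn X Y)) (rep p)"
        by (simp add: lft_conn lft_field_scale conn_in field_scale_in p x X Y h
            linear_scale[OF linear_td_lft[OF Y x]] linear_scale[OF linear_hproj])
    qed (intro conn_in field_scale_in X Y h)+
    have Xh: "smooth_quot_fun (\<lambda>p. X p h)" by (rule vector_fieldsD(3)[OF X h])
    show "conn X (field_scale h Y) = field_add (field_scale (\<lambda>p. X p h) Y) (field_scale h (conn X Y))"
    proof (rule field_eqI)
      fix p :: "('n, 'd) tall set" assume p: "p \<in> quot_mfd"
      note x = rep_in[OF p]
      \<comment> \<open>In the Leibniz rule the term with the derivative of h is a multiple of the
        lift of Y, which is horizontal and so survives the projection unchanged; its coefficient is
        X applied to h.\<close>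
      show "lft (conn X (field_scale h Y)) (rep p)
          = lft (field_add (field_scale (\<lambda>p. X p h) Y) (field_scale h (conn X Y))) (rep p)"
        by (simp add: lft_conn lft_field_scale lft_field_add conn_in field_scale_in p x X Y h Xh td_lft_scale lft_tangent
            linear_add[OF linear_hproj] linear_scale[OF linear_hproj] field_apply hproj_id lft_horizontal)
    qed (intro conn_in field_scale_in field_add_in X Y h Xh)+
  }
qed

lemma bounded_bilinear_tangent_form:
  "bounded_bilinear (\<lambda>A B :: ('n::finite, 'd::finite) tall. blk A i ** transpose (blk B i) + blk B i ** transpose (blk A i))"
proof -
  have "bilinear (\<lambda>A B :: ('n, 'd) tall. blk A i ** transpose (blk B i) + blk B i ** transpose (blk A i))"
    unfolding bilinear_def
    by (auto intro!: linearI simp: blk_simps transpose_simps matrix_mult_simps algebra_simps)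
  then show ?thesis by (simp add: bilinear_conv_bounded_bilinear)
qed

(* Differentiating the tangency equation of Y along X gives a form symmetric in X and Y. *)
lemma bracket_tangent:
  fixes X Y :: "('n::finite, 'd::finite) tall \<Rightarrow> ('n, 'd) tall"
  assumes X: "smO X" "\<And>y. y \<in> orth_prod \<Longrightarrow> X y \<in> tanO y"
    and Y: "smO Y" "\<And>y. y \<in> orth_prod \<Longrightarrow> Y y \<in> tanO y" and x: "x \<in> orth_prod"
  shows "tdO Y x (X x) - tdO X x (Y x) \<in> tanO x"
proof -
  define b where "b i A B = blk A i ** transpose (blk B i) + blk B i ** transpose (blk A i)"
    for i and A B :: "('n, 'd) tall"
  have bb: "bounded_bilinear (b i)" for i unfolding b_def by (rule bounded_bilinear_tangent_form)
  have key: "b i (tdO W x v) x = - b i (W x) v"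
    if W: "smO W" "\<And>y. y \<in> orth_prod \<Longrightarrow> W y \<in> tanO y" and v: "v \<in> tanO x" for W v i
  proof -
    have "b i (W y) y = 0" if "y \<in> orth_prod" for y
      using W(2)[OF that] by (simp add: tangent_orth_prod b_def)
    then have "tdO (\<lambda>y. b i (W y) y) x v = tdO (\<lambda>y. 0) x v" by (simp cong: tangent_deriv_cong)
    then have "b i (W x) v + b i (tdO W x v) x = 0"
      by (simp add: tangent_deriv_bilinear[OF v W(1) smooth_map_on_ident bb] tangent_deriv_const[OF v] tangent_deriv_ident[OF v])
    then show ?thesis by (simp add: add_eq_0_iff)
  qed
  have "b i (tdO Y x (X x) - tdO X x (Y x)) x = 0" for i
    using key[OF X Y(2)[OF x], of i] key[OF Y X(2)[OF x], of i]
    by (simp add: bounded_bilinear.diff_left[OF bb]) (simp add: b_def add.commute)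
  then show ?thesis using x by (simp add: tangent_orth_prod b_def)
qed

lemma torsion_free_conn: "torsion_free conn"
  unfolding torsion_free_def
proof (intro ballI allI impI)
  fix X Y :: "('n::finite, 'd::finite) qfield" and p :: "('n, 'd) tall set" and \<phi> :: "('n, 'd) tall set \<Rightarrow> real"
  assume X: "X \<in> vector_fields" and Y: "Y \<in> vector_fields" and p: "p \<in> quot_mfd" and \<phi>: "smooth_quot_fun \<phi>"
  define x where "x = rep p"
  have x: "x \<in> orth_prod" "quot x = p" using rep_in[OF p] quot_rep[OF p] by (auto simp: x_def)
  let ?F = "\<lambda>y. \<phi> (quot y)"
  let ?u = "tdO (lft Y) x (lft X x)" and ?w = "tdO (lft X) x (lft Y x)"
  have uw: "?u - ?w \<in> tanO x"
    by (intro bracket_tangent smO_lft lft_tangent X Y x)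
  have second: "V p (\<lambda>q. W q \<phi>) = tdO (\<lambda>y. tdO ?F y (lft W y)) x (lft V x)"
    if V: "V \<in> vector_fields" and W: "W \<in> vector_fields" for V W :: "('n, 'd) qfield"
    using field_apply[OF V x(1) vector_fieldsD(3)[OF W \<phi>]]
    by (simp add: x(2) field_apply[OF W _ \<phi>] cong: tangent_deriv_cong)
  have "conn X Y p \<phi> - conn Y X p \<phi> = tvec x (hproj x ?u) \<phi> - tvec x (hproj x ?w) \<phi>"
    by (simp add: conn_def X Y mkfield_def p flip: x_def)
  also have "\<dots> = tvec x (hproj x (?u - ?w)) \<phi>"
    by (simp add: linear_diff[OF linear_hproj] linear_diff[OF linear_tvec[OF x(1)]])
  \<comment> \<open>A derivation ignores \<open>hproj\<close> only on tangent vectors, hence on the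
    difference and not on the two terms separately.\<close>
  also have "\<dots> = tdO ?F x (?u - ?w)"
    by (simp add: tvec_hproj[OF uw] tvec_smooth[OF \<phi>])
  also have "\<dots> = X p (\<lambda>q. Y q \<phi>) - Y p (\<lambda>q. X q \<phi>)"
    unfolding second[OF X Y] second[OF Y X]
    by (rule tangent_deriv_bracket[symmetric])
      (use \<phi> x uw in \<open>simp_all add: smooth_quot_fun_iff smO_lft lft_tangent X Y\<close>)
  finally show "conn X Y p \<phi> - conn Y X p \<phi> = X p (\<lambda>q. Y q \<phi>) - Y p (\<lambda>q. X q \<phi>)" .
qed

lemma quot_metric_fields:
  assumes "X \<in> vector_fields" "Y \<in> vector_fields" "x \<in> orth_prod"
  shows "quot_metric (quot x) (X (quot x)) (Y (quot x)) = lft X x \<bullet> lft Y x"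
  unfolding lft_def by (intro quot_metric_eq assms vector_fieldsD(1) quot_in)

lemma metric_compatible_conn: "metric_compatible conn"
  unfolding metric_compatible_def
proof (intro ballI)
  fix X Y Z :: "('n::finite, 'd::finite) qfield" and p :: "('n, 'd) tall set"
  assume X: "X \<in> vector_fields" and Y: "Y \<in> vector_fields" and Z: "Z \<in> vector_fields" and p: "p \<in> quot_mfd"
  define x where "x = rep p"
  have x: "x \<in> orth_prod" "quot x = p" using rep_in[OF p] quot_rep[OF p] by (auto simp: x_def)
  have sm: "smO (\<lambda>y. lft Y y \<bullet> lft Z y)"
    by (intro smooth_map_on_bilinear[OF bounded_bilinear_inner] smO_lft Y Z)
  have "smooth_quot_fun (\<lambda>q. quot_metric q (Y q) (Z q))"
    unfolding smooth_quot_fun_iff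
    by (rule smooth_map_on_cong[THEN iffD1, OF _ sm]) (simp add: quot_metric_fields Y Z)
  from field_apply[OF X x(1) this]
  have "X p (\<lambda>q. quot_metric q (Y q) (Z q)) = tdO (\<lambda>y. lft Y y \<bullet> lft Z y) x (lft X x)"
    by (simp add: quot_metric_fields Y Z x(2) cong: tangent_deriv_cong)
  also have "\<dots> = lft Y x \<bullet> tdO (lft Z) x (lft X x) + tdO (lft Y) x (lft X x) \<bullet> lft Z x"
    by (intro tangent_deriv_bilinear[OF _ _ _ bounded_bilinear_inner] lft_tangent smO_lft X Y Z x)
  also have "\<dots> = lft Y x \<bullet> lft (conn X Z) x + lft (conn X Y) x \<bullet> lft Z x"
    unfolding x_def lft_conn[OF X Z p] lft_conn[OF X Y p]
    using x(1) by (simp add: inner_hproj lft_horizontal Y Z inner_commute[of "lft Y _"] flip: x_def)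
  also have "\<dots> = quot_metric p (conn X Y p) (Z p) + quot_metric p (Y p) (conn X Z p)"
    using quot_metric_fields[OF conn_in[OF X Y] Z x(1)] quot_metric_fields[OF Y conn_in[OF X Z] x(1)] by (simp add: x(2))
  finally show "X p (\<lambda>q. quot_metric q (Y q) (Z q)) = quot_metric p (conn X Y p) (Z p) + quot_metric p (Y p) (conn X Z p)" .
qed

(* The difference of two such connections is symmetric in its first two and skew in its last two
   arguments, hence zero. *)
lemma levi_civita_unique:
  fixes D D' :: "('n::finite, 'd::finite) qfield \<Rightarrow> ('n, 'd) qfield \<Rightarrow> ('n, 'd) qfield"
  assumes D: "affine_connection D" "torsion_free D" "metric_compatible D"
    and D': "affine_connection D'" "torsion_free D'" "metric_compatible D'"
    and X: "X \<in> vector_fields" and Y: "Y \<in> vector_fields"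
  shows "D X Y = D' X Y"
proof (rule field_eqI)
  have Din: "D V W \<in> vector_fields" "D' V W \<in> vector_fields" if "V \<in> vector_fields" "W \<in> vector_fields" for V W
    using D(1)[unfolded affine_connection_def, THEN conjunct1] D'(1)[unfolded affine_connection_def, THEN conjunct1]
      that by simp_all
  show "D X Y \<in> vector_fields" "D' X Y \<in> vector_fields" using Din[OF X Y] .
  fix p :: "('n, 'd) tall set" assume p: "p \<in> quot_mfd"
  define x where "x = rep p"
  have x: "x \<in> orth_prod" "quot x = p" using rep_in[OF p] quot_rep[OF p] by (auto simp: x_def)
  define \<delta> where "\<delta> V W = lft (D V W) x - lft (D' V W) x" for V W
  have \<delta>_hor: "\<delta> V W \<in> horizontal_space x" if "V \<in> vector_fields" "W \<in> vector_fields" for V W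
    unfolding \<delta>_def by (intro subspace_diff[OF subspace_horizontal] lft_horizontal x Din that)
  have \<delta>_sym: "\<delta> V W = \<delta> W V" if V: "V \<in> vector_fields" and W: "W \<in> vector_fields" for V W
  proof (rule tvec_inj[OF x(1) \<delta>_hor[OF V W] \<delta>_hor[OF W V]], rule ext)
    fix \<phi>
    show "tvec x (\<delta> V W) \<phi> = tvec x (\<delta> W V) \<phi>"
    proof (cases "smooth_quot_fun \<phi>")
      case True
      \<comment> \<open>Torsion-freeness equates both sides with the same commutator of V and W, in
        which no connection occurs.\<close>
      have "D V W p \<phi> - D W V p \<phi> = D' V W p \<phi> - D' W V p \<phi>"
        using D(2) D'(2) V W p True unfolding torsion_free_def by simp
      then show ?thesis
        by (simp add: \<delta>_def linear_diff[OF linear_tvec[OF x(1)]] tvec_lft Din V W x)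
    qed (simp add: tvec_not_smooth)
  qed
  have \<delta>_skew: "\<delta> V W \<bullet> lft Z x = - (\<delta> V Z \<bullet> lft W x)"
    if V: "V \<in> vector_fields" and W: "W \<in> vector_fields" and Z: "Z \<in> vector_fields" for V W Z
  proof -
    have "quot_metric p (D V W p) (Z p) + quot_metric p (W p) (D V Z p)
        = quot_metric p (D' V W p) (Z p) + quot_metric p (W p) (D' V Z p)"
      using D(3)[unfolded metric_compatible_def, rule_format, OF V W Z p]
        D'(3)[unfolded metric_compatible_def, rule_format, OF V W Z p] by (rule trans[OF sym])
    then have "lft (D V W) x \<bullet> lft Z x + lft W x \<bullet> lft (D V Z) x
        = lft (D' V W) x \<bullet> lft Z x + lft W x \<bullet> lft (D' V Z) x"
      using quot_metric_fields[OF _ _ x(1)] Din V W Z by (simp add: x(2))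
    then show ?thesis by (simp add: \<delta>_def inner_diff_left inner_commute[of "lft W x"])
  qed
  \<comment> \<open>Skewness is available for values of smooth fields, so the vector
    \<open>\<delta> X Y\<close> is extended to a field before it serves as a test vector.\<close>
  obtain Z where Z: "Z \<in> vector_fields" "lft Z x = \<delta> X Y"
    using field_extends[OF p] \<delta>_hor[OF X Y] unfolding x_def by metis
  \<comment> \<open>Skewness and symmetry are applied alternately, three times each; the arguments
    return to their places while the sign has changed three times.\<close>
  have "\<delta> X Y \<bullet> lft Z x = - (\<delta> X Y \<bullet> lft Z x)"
    using \<delta>_skew[OF X Y Z(1)] \<delta>_sym[OF X Z(1)] \<delta>_skew[OF Z(1) X Y] \<delta>_sym[OF Z(1) Y]
      \<delta>_skew[OF Y Z(1) X] \<delta>_sym[OF Y X] by simp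
  then have "\<delta> X Y = 0" by (simp add: Z(2))
  then show "lft (D X Y) (rep p) = lft (D' X Y) (rep p)" by (simp add: \<delta>_def x_def)
qed

lemma levi_civita_eq: "levi_civita = (conn :: ('n::finite, 'd::finite) qfield \<Rightarrow> _)"
  unfolding levi_civita_def
proof (rule the_equality)
  show "affine_connection (conn :: ('n, 'd) qfield \<Rightarrow> _) \<and> torsion_free (conn :: ('n, 'd) qfield \<Rightarrow> _) \<and>
    metric_compatible (conn :: ('n, 'd) qfield \<Rightarrow> _) \<and>
    (\<forall>(X :: ('n, 'd) qfield) Y. X \<notin> vector_fields \<or> Y \<notin> vector_fields \<longrightarrow> conn X Y = (\<lambda>p \<phi>. 0))"
    by (auto simp: affine_connection_conn torsion_free_conn metric_compatible_conn conn_def)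
next
  fix D :: "('n, 'd) qfield \<Rightarrow> ('n, 'd) qfield \<Rightarrow> ('n, 'd) qfield"
  assume D: "affine_connection D \<and> torsion_free D \<and> metric_compatible D \<and>
    (\<forall>X Y. X \<notin> vector_fields \<or> Y \<notin> vector_fields \<longrightarrow> D X Y = (\<lambda>p \<phi>. 0))"
  show "D = conn"
  proof (intro ext)
    fix X Y p \<phi>
    have "D X Y = conn X Y"
    proof (cases "X \<in> vector_fields \<and> Y \<in> vector_fields")
      case True
      then show ?thesis
        using levi_civita_unique[of D conn X Y] D affine_connection_conn torsion_free_conn metric_compatible_conn
        by blast
    next
      case False
      then have "D X Y = (\<lambda>p \<phi>. 0)" using D by blast
      then show ?thesis using False by (auto simp: conn_def)
    qed
    then show "D X Y p \<phi> = conn X Y p \<phi>" by simp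
  qed
qed


section \<open>The gradient and the Hessian\<close>

definition grad_lift :: "('n::finite, 'd::finite) big \<Rightarrow> ('n, 'd) tall \<Rightarrow> ('n, 'd) tall" where
  "grad_lift C x = (- 2) *\<^sub>R (S_mat C x ** x)"

text \<open>The form with \<open>S_mat\<close> is the one to differentiate; this form exhibits twice
  the tangent projection of \<open>C ** x\<close>, from which tangency and smoothness
  follow.\<close>

lemma grad_lift_tproj: "grad_lift C x = 2 *\<^sub>R tproj x (C ** x)"
  by (simp add: grad_lift_def S_mat_def tproj_def matrix_mult_simps scaleR_diff_right)

lemma transpose_symblockdiag: "transpose (symblockdiag M) = symblockdiag M"
  by (auto simp: symblockdiag_def transpose_def vec_eq_iff)

lemma transpose_S_mat: "transpose C = C \<Longrightarrow> transpose (S_mat C x) = S_mat C x"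
  by (simp add: S_mat_def transpose_simps transpose_symblockdiag)

text \<open>Symmetry of C makes \<open>transpose x ** grad_lift C x\<close> symmetric, while
  tangency makes it skew, so it vanishes.\<close>

lemma grad_lift_horizontal:
  assumes C: "transpose C = C" and x: "x \<in> orth_prod"
  shows "grad_lift C x \<in> horizontal_space x"
proof -
  have T: "grad_lift C x \<in> tanO x"
    unfolding grad_lift_tproj by (intro subspace_scale[OF subspace_tangent] tproj_tangent x)
  have "transpose (transpose x ** grad_lift C x) = transpose x ** grad_lift C x"
    by (simp add: grad_lift_def transpose_simps matrix_mult_simps transpose_S_mat[OF C] matrix_mul_assoc)
  with tangent_gram_skew[OF T] have "(transpose x ** grad_lift C x) \<bullet> (transpose x ** grad_lift C x) = 0"
    using inner_sym_skew by blast
  then have "transpose x ** grad_lift C x = 0" by simp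
  with T show ?thesis by (simp add: horizontal_space_eq[OF x])
qed

lemma smO_grad_lift: "smO (grad_lift C)"
  unfolding grad_lift_tproj tproj_def
  by (intro smooth_map_on_diff smO_mult smO_transpose smooth_map_on_ident smooth_map_on_const
      smooth_map_on_bounded_linear[OF bounded_linear_scaleR_right]
      smooth_map_on_bounded_linear[OF bounded_linear_of_linear[OF linear_symblockdiag]])

section \<open>The trace form of a fixed symmetric matrix\<close>

context
  fixes C :: "('n::finite, 'd::finite) big" and f :: "('n, 'd) tall set \<Rightarrow> real"
  assumes C: "transpose C = C"
    and f: "\<And>X. X \<in> orth_prod \<Longrightarrow> f (quot X) = trace (transpose X ** C ** X)"
begin

lemma trace_form_inner: "x \<in> orth_prod \<Longrightarrow> f (quot x) = x \<bullet> (C ** x)"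
  by (simp add: f inner_matrix matrix_mul_assoc)

lemma smO_trace_form: "smO (\<lambda>x. x \<bullet> (C ** x))"
  by (intro smooth_map_on_bilinear[OF bounded_bilinear_inner] smO_mult smooth_map_on_const smooth_map_on_ident)

lemma smooth_trace_form: "smooth_quot_fun f"
  unfolding smooth_quot_fun_iff by (rule smooth_map_on_cong[THEN iffD1, OF _ smO_trace_form]) (simp add: trace_form_inner)

text \<open>For symmetric C the product rule gives twice the inner product of \<open>C ** x\<close>
  with v; since v is tangent, \<open>C ** x\<close> may be replaced by its tangent
  projection.\<close>

lemma tvec_trace_form:
  assumes v: "v \<in> tanO x"
  shows "tvec x v f = grad_lift C x \<bullet> v"
proof -
  have "tvec x v f = tdO (\<lambda>x. x \<bullet> (C ** x)) x v"
    unfolding tvec_smooth[OF smooth_trace_form] by (simp add: trace_form_inner cong: tangent_deriv_cong)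
  also have "\<dots> = x \<bullet> tdO (\<lambda>x. C ** x) x v + tdO (\<lambda>x. x) x v \<bullet> (C ** x)"
    by (rule tangent_deriv_bilinear[OF v smooth_map_on_ident _ bounded_bilinear_inner])
      (intro smO_mult smooth_map_on_const smooth_map_on_ident)
  also have "\<dots> = x \<bullet> (C ** v) + v \<bullet> (C ** x)"
    by (simp add: tangent_deriv_ident[OF v]
        tangent_deriv_bounded_linear[OF v smooth_map_on_ident bounded_bilinear.bounded_linear_right[OF bounded_bilinear_matrix_mult]])
  also have "\<dots> = 2 * ((C ** x) \<bullet> v)"
    using inner_mult_left[of C x v] C by (simp add: inner_commute)
  also have "\<dots> = grad_lift C x \<bullet> v"
    using inner_tproj[OF v, of "C ** x"] by (simp add: grad_lift_tproj inner_diff_left)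
  finally show ?thesis .
qed

lemma quot_grad_quot:
  assumes x: "x \<in> orth_prod"
  shows "quot_grad f (quot x) = tvec x (grad_lift C x)"
proof -
  let ?T = "quot_tangent_space (quot x)"
  note hor = grad_lift_horizontal[OF C x]
  have "(THE \<eta>. \<eta> \<in> ?T \<and> (\<forall>\<xi>\<in>?T. quot_metric (quot x) \<eta> \<xi> = \<xi> f)) = tvec x (grad_lift C x)"
  proof (rule the_equality)
    show "tvec x (grad_lift C x) \<in> ?T \<and> (\<forall>\<xi>\<in>?T. quot_metric (quot x) (tvec x (grad_lift C x)) \<xi> = \<xi> f)"
      using hor x
      by (auto simp: quot_tangent_space_eq quot_metric_eq horizontal_lift_tvec tvec_trace_form horizontal_tangent)
  next
    fix \<eta> assume \<eta>: "\<eta> \<in> ?T \<and> (\<forall>\<xi>\<in>?T. quot_metric (quot x) \<eta> \<xi> = \<xi> f)"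
    then obtain w where w: "w \<in> horizontal_space x" "\<eta> = tvec x w" by (auto simp: quot_tangent_space_eq[OF x])
    have eq: "w \<bullet> v = grad_lift C x \<bullet> v" if v: "v \<in> horizontal_space x" for v
    proof -
      have "tvec x v \<in> ?T" using v by (simp add: quot_tangent_space_eq[OF x])
      then have "quot_metric (quot x) \<eta> (tvec x v) = tvec x v f" using \<eta> by blast
      then show ?thesis
        using \<eta> w v x \<open>tvec x v \<in> ?T\<close> by (simp add: quot_metric_eq horizontal_lift_tvec tvec_trace_form horizontal_tangent)
    qed
    have "w - grad_lift C x \<in> horizontal_space x"
      by (intro subspace_diff[OF subspace_horizontal] w hor x)
    from eq[OF this] have "(w - grad_lift C x) \<bullet> (w - grad_lift C x) = 0" by (simp add: inner_diff_left)
    then show "\<eta> = tvec x (grad_lift C x)" by (simp add: w(2))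
  qed
  then show ?thesis by (simp add: quot_grad_def quot_in[OF x])
qed

text \<open>Smoothness of the gradient field is what makes the nontrivial branch of the connection
  apply to it.\<close>

lemma quot_grad_in: "quot_grad f \<in> vector_fields"
proof -
  have "quot_grad f = mkfield (grad_lift C)"
  proof
    fix p
    show "quot_grad f p = mkfield (grad_lift C) p"
    proof (cases "p \<in> quot_mfd")
      case True
      then show ?thesis using quot_grad_quot[OF rep_in[OF True]] by (simp add: quot_rep mkfield_def)
    qed (simp add: quot_grad_def mkfield_def)
  qed
  then show ?thesis
    using mkfield_in[OF smO_grad_lift] grad_lift_horizontal[OF C] horizontal_tangent by metis
qed

lemma lft_quot_grad: "x \<in> orth_prod \<Longrightarrow> lft (quot_grad f) x = grad_lift C x"
  by (intro lft_eqI quot_grad_quot grad_lift_horizontal[OF C])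

(* The derivative of S contributes a symmetric block diagonal multiple of x, which is normal. *)
lemma hproj_td_grad_lift:
  assumes h: "h \<in> tanO x"
  shows "hproj x (tdO (grad_lift C) x h) = hproj x ((- 2) *\<^sub>R (S_mat C x ** h))"
proof -
  have x: "x \<in> orth_prod" by (rule tangent_space_base[OF h])
  let ?N = "\<lambda>y. C ** y ** transpose y"
  have smN: "smO ?N"
    by (intro smO_mult smO_transpose smooth_map_on_const smooth_map_on_ident)
  have bs: "bounded_linear (symblockdiag :: ('n, 'd) big \<Rightarrow> _)"
    by (rule bounded_linear_of_linear[OF linear_symblockdiag])
  have smS: "smO (S_mat C)"
    unfolding S_mat_def
    by (intro smooth_map_on_diff smooth_map_on_const smooth_map_on_bounded_linear[OF bs] smN)
  define N' where "N' = tdO ?N x h"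
  have S': "tdO (S_mat C) x h = symblockdiag N'"
    unfolding S_mat_def N'_def
    by (simp add: tangent_deriv_diff[OF h smooth_map_on_bounded_linear[OF bs smN] smooth_map_on_const]
        tangent_deriv_const[OF h] tangent_deriv_bounded_linear[OF h smN bs])
  have "tdO (grad_lift C) x h = (- 2) *\<^sub>R tdO (\<lambda>y. S_mat C y ** y) x h"
    unfolding grad_lift_def
    by (rule tangent_deriv_bounded_linear[OF h _ bounded_linear_scaleR_right]) (intro smO_mult smS smooth_map_on_ident)
  also have "tdO (\<lambda>y. S_mat C y ** y) x h = S_mat C x ** h + symblockdiag N' ** x"
    by (simp add: tangent_deriv_bilinear[OF h smS smooth_map_on_ident bounded_bilinear_matrix_mult]
        tangent_deriv_ident[OF h] S')
  finally have "tdO (grad_lift C) x h = (- 2) *\<^sub>R (S_mat C x ** h) + (- 2) *\<^sub>R (symblockdiag N' ** x)"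
    by (simp add: scaleR_add_right)
  moreover have "tproj x (symblockdiag N' ** x) = 0"
    by (rule tproj_eqI[where A = "\<lambda>i. (1/2) *\<^sub>R (blk2 N' i i + transpose (blk2 N' i i))"])
      (use x in \<open>simp_all add: subspace_0[OF subspace_tangent] blk_symblockdiag_mult transpose_simps add.commute\<close>)
  then have "hproj x (symblockdiag N' ** x) = 0" by (simp add: hproj_def matrix_mult_simps)
  ultimately show ?thesis
    by (simp only: linear_add[OF linear_hproj] linear_scale[OF linear_hproj]) simp
qed

text \<open>At p the connection sees the direction field only through its lift at
  \<open>rep p\<close>, which is the lift of H for every admissible extension. All extensions
  therefore give the same value.\<close>

lemma quot_Hess_rep:
  assumes p: "p \<in> quot_mfd" and H: "H \<in> quot_tangent_space p"
  shows "quot_Hess f p H = tvec (rep p) (hproj (rep p) ((- 2) *\<^sub>R (S_mat C (rep p) ** horizontal_lift (rep p) H)))"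
    (is "_ = ?E")
proof -
  note x = rep_in[OF p] and q = quot_rep[OF p]
  have H': "H \<in> quot_tangent_space (quot (rep p))" using H q by simp
  have val: "levi_civita X (quot_grad f) p = ?E" if X: "X \<in> vector_fields" "X p = H" for X
  proof -
    have l: "lft X (rep p) = horizontal_lift (rep p) H" by (simp add: lft_def q X(2))
    have "tdO (lft (quot_grad f)) (rep p) = tdO (grad_lift C) (rep p)"
      by (simp add: lft_quot_grad cong: tangent_deriv_cong)
    then show ?thesis
      using hproj_td_grad_lift[OF lft_tangent[OF X(1) x]] X(1) quot_grad_in p
      by (simp add: levi_civita_eq conn_def mkfield_def l)
  qed
  \<comment> \<open>Some field must extend H: over an empty family of extensions the condition in
    \<open>quot_Hess\<close> would hold for every candidate and determine nothing.\<close>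
  obtain X where X: "X \<in> vector_fields" "lft X (rep p) = horizontal_lift (rep p) H"
    using field_extends[OF p horizontal_lift_in[OF x H']] by metis
  have "X p = H" using tvec_lft[OF X(1) x] tvec_horizontal_lift[OF x H'] by (simp add: X(2) q)
  then show ?thesis
    unfolding quot_Hess_def using val X(1) by (intro the_equality) auto
qed

end

section \<open>Equivariance under right multiplication by orthogonal matrices\<close>

lemma S_mat_mult: "orthogonal_matrix Q \<Longrightarrow> S_mat C (x ** Q) = S_mat C x"
proof -
  assume Q: "orthogonal_matrix Q"
  have "C ** (x ** Q) ** transpose (x ** Q) = C ** x ** (Q ** transpose Q) ** transpose x"
    by (simp add: transpose_simps matrix_mul_assoc)
  then show ?thesis using Q by (simp add: S_mat_def orthogonal_matrix_def)
qed

lemma tproj_mult: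
  assumes "orthogonal_matrix Q"
  shows "tproj (x ** Q) (W ** Q) = tproj x W ** Q"
proof -
  have "W ** Q ** transpose (x ** Q) = W ** (Q ** transpose Q) ** transpose x"
    by (simp add: transpose_simps matrix_mul_assoc)
  also have "\<dots> = W ** transpose x" using assms by (simp add: orthogonal_matrix_def)
  finally show ?thesis by (simp add: tproj_def matrix_mult_simps matrix_mul_assoc)
qed

lemma hproj_mult:
  assumes "orthogonal_matrix Q"
  shows "hproj (x ** Q) (W ** Q) = hproj x W ** Q"
proof -
  have "x ** Q ** (transpose (x ** Q) ** (V ** Q)) = x ** (transpose x ** V) ** Q" for V
  proof -
    have "x ** Q ** (transpose (x ** Q) ** (V ** Q)) = x ** (Q ** transpose Q) ** (transpose x ** V) ** Q"
      by (simp add: transpose_simps matrix_mul_assoc)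
    also have "\<dots> = x ** (transpose x ** V) ** Q" using assms by (simp add: orthogonal_matrix_def)
    finally show ?thesis .
  qed
  then show ?thesis
    by (simp add: hproj_def tproj_mult[OF assms] matrix_mult_simps)
qed

theorem lemma3p4:
  fixes C :: "real ^ ('n::finite \<times> 'd::finite) ^ ('n \<times> 'd)"
    and f :: "(real ^ 'd ^ ('n \<times> 'd)) set \<Rightarrow> real"
    and p :: "(real ^ 'd ^ ('n \<times> 'd)) set"
    and G :: "real ^ 'd ^ ('n \<times> 'd)"
    and H :: "((real ^ 'd ^ ('n \<times> 'd)) set \<Rightarrow> real) \<Rightarrow> real"
  assumes C_sym: "transpose C = C"
    and f_def: "\<And>X. X \<in> orth_prod \<Longrightarrow> f (quot X) = trace (transpose X ** C ** X)"
    and p: "p \<in> quot_mfd"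
    and G: "G \<in> orth_prod" "quot G = p"
    and H: "H \<in> quot_tangent_space p"
  shows "(\<exists>!v. is_horizontal_lift G (quot_Hess f p H) v) \<and>
    horizontal_lift G (quot_Hess f p H) =
      (mat 1 - (1 / real CARD('n)) *\<^sub>R (G ** transpose G)) **
        orth_proj (tangent_space orth_prod G)
          ((- 2) *\<^sub>R (S_mat C G ** horizontal_lift G H))"
proof -
  define x where "x = rep p"
  have x: "x \<in> orth_prod" "quot x = p" using rep_in[OF p] quot_rep[OF p] by (auto simp: x_def)
  \<comment> \<open>The Hessian is known at the chosen representative x; Q carries it to the
    prescribed G.\<close>
  obtain Q where Q: "orthogonal_matrix Q" "G = x ** Q" using x(2) G(2) by (metis quot_eq_iff)
  let ?W = "(- 2) *\<^sub>R (S_mat C x ** horizontal_lift x H)"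
  let ?V = "(- 2) *\<^sub>R (S_mat C G ** horizontal_lift G H)"
  have "horizontal_lift G H = horizontal_lift x H ** Q"
    unfolding Q(2) using H x by (intro horizontal_lift_mult Q) auto
  then have "?V = ?W ** Q"
    by (simp add: Q(2) S_mat_mult[OF Q(1)] matrix_mult_simps matrix_mul_assoc)
  then have hV: "hproj G ?V = hproj x ?W ** Q"
    by (simp only: Q(2) hproj_mult[OF Q(1)])
  have "quot_Hess f p H = tvec x (hproj x ?W)"
    unfolding x_def by (rule quot_Hess_rep[OF C_sym f_def p H])
  \<comment> \<open>Translating both the base point and the horizontal vector by Q leaves the
    tangent vector of the quotient unchanged.\<close>
  also have "\<dots> = tvec G (hproj G ?V)"
    unfolding hV unfolding Q(2) by (intro tvec_mult[symmetric] horizontal_tangent hproj_horizontal x Q)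
  finally have Hess: "quot_Hess f p H = tvec G (hproj G ?V)" .
  have hor: "hproj G ?V \<in> horizontal_space G" by (rule hproj_horizontal[OF G(1)])
  have "\<exists>!v. is_horizontal_lift G (quot_Hess f p H) v"
    unfolding is_horizontal_lift_iff Hess using hor tvec_inj[OF G(1)] by blast
  moreover have "horizontal_lift G (quot_Hess f p H) = hproj G ?V"
    unfolding Hess by (rule horizontal_lift_tvec[OF G(1) hor])
  moreover have "hproj G ?V = (mat 1 - (1 / real CARD('n)) *\<^sub>R (G ** transpose G)) ** orth_proj (tanO G) ?V"
    unfolding orth_proj_tangent[OF G(1)] hproj_def by (simp add: matrix_mult_simps matrix_mul_assoc)
  ultimately show ?thesis by simp
qed

end
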